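(* For $r$ a positive integer and $\rho$ a function on the positive integers, let $f_r(T)$ be the formal power series defined by $$f_r(T):=\sum_{\lambda\in\mathscr{P}} T^{|\lambda|}\prod_{h\in\mathscr{H}^{(b)}(\lambda)}\rho(rh).$$ Then $$\sum_{\substack{\lambda\in\mathscr{P}\\ r\text{-core}(\lambda)=\omega}} T^{(|\lambda|-|\omega|)/r}\prod_{h\in\mathscr{H}^{(b)}_r(\lambda)}\rho(h)=\frac{f_r(T)}{(T;T)_\infty^{r-1}},$$ where $\omega$ is an $r$-core.
   Context: $\mathscr{P}$ is the set of all integer partitions $\lambda=(\lambda_1,\lambda_2,\dots)$ (weakly decreasing sequences of nonnegative integers with finitely many nonzero terms, including the empty partition $0$), and $|\lambda|=\sum_i\lambda_i$. A partition is identified with its Young diagram $\{(i,j): 1\le j\le\lambda_i\}$; $\lambda'$ is the conjugate partition. For a square $s=(i,j)\in\lambda$: arm-length $a(s)=\lambda_i-j$, leg-length $l(s)=\lambda'_j-i$, hook-length $h(s)=a(s)+l(s)+1$. A bottom square is a square $s\in\lambda$ with $l(s)=0$. $\mathscr{H}^{(b)}_r(\lambda)$ is the multiset of hook-lengths of bottom squares of $\lambda$ that are congruent to $0$ modulo $r$, and $\mathscr{H}^{(b)}(\lambda):=\mathscr{H}^{(b)}_1(\lambda)$. An $r$-core is a partition none of whose hook-lengths is a multiple of $r$. The $r$-core of a partition $\lambda$, denoted $r\text{-core}(\lambda)$, is obtained as follows: let $(s_k)_{k\in\mathbb{Z}}$ be the $0/1$-sequence of $\lambda$, where $s_k=0$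 if $k=\lambda_i-i$ for some $i\ge1$ and $s_k=1$ otherwise; in each of the $r$ subsequences $(s_{i+rj})_{j\in\mathbb{Z}}$, $0\le i\le r-1$, move all zeros to the left past the ones (i.e. repeatedly exchange $s_k=1$, $s_{k+r}=0$ for $s_k=0$, $s_{k+r}=1$ until this is no longer possible); the resulting sequence is the $0/1$-sequence of $r\text{-core}(\lambda)$. $(a;q)_\infty=\prod_{j\ge0}(1-aq^j)$, so $(T;T)_\infty=\prod_{k\ge1}(1-T^k)$. Identities are in the sense of formal power series in $T$; $\rho$ takes values in a commutative ring with identity. Products over multisets are taken with multiplicity, and empty products are $1$. *)

theory Defs
  imports "HOL-Analysis.Analysis" "HOL-Computational_Algebra.Formal_Power_Series"
begin

text \<open>
  Indices start at 0: the value \<open>lam i\<close> is the part usually written with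
  subscript \<open>i + 1\<close>, and the square \<open>(i, j)\<close> is the one usually written
  \<open>(i + 1, j + 1)\<close>.
\<close>

definition partitions :: "(nat \<Rightarrow> nat) set" where
  "partitions = {lam. decseq lam \<and> finite {i. lam i \<noteq> 0}}"

definition psize :: "(nat \<Rightarrow> nat) \<Rightarrow> nat" where
  "psize lam = (\<Sum>i | lam i \<noteq> 0. lam i)"

definition conjugate :: "(nat \<Rightarrow> nat) \<Rightarrow> nat \<Rightarrow> nat" where
  "conjugate lam j = card {i. j < lam i}"

definition diagram :: "(nat \<Rightarrow> nat) \<Rightarrow> (nat \<times> nat) set" where
  "diagram lam = {(i, j). j < lam i}"

text \<open>The subtractions in the next two definitions do not truncate on squares of the diagram.\<close>

definition arm :: "(nat \<Rightarrow> nat) \<Rightarrow> nat \<times> nat \<Rightarrow> nat" where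
  "arm lam = (\<lambda>(i, j). lam i - (j + 1))"

definition leg :: "(nat \<Rightarrow> nat) \<Rightarrow> nat \<times> nat \<Rightarrow> nat" where
  "leg lam = (\<lambda>(i, j). conjugate lam j - (i + 1))"

definition hook :: "(nat \<Rightarrow> nat) \<Rightarrow> nat \<times> nat \<Rightarrow> nat" where
  "hook lam s = arm lam s + leg lam s + 1"

definition bottom_squares :: "(nat \<Rightarrow> nat) \<Rightarrow> (nat \<times> nat) set" where
  "bottom_squares lam = {s \<in> diagram lam. leg lam s = 0}"

definition bottom_hooks :: "nat \<Rightarrow> (nat \<Rightarrow> nat) \<Rightarrow> nat multiset" where
  "bottom_hooks r lam =
     filter_mset (\<lambda>h. r dvd h) (image_mset (hook lam) (mset_set (bottom_squares lam)))"

definition is_r_core :: "nat \<Rightarrow> (nat \<Rightarrow> nat) \<Rightarrow> bool" where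
  "is_r_core r lam \<longleftrightarrow> lam \<in> partitions \<and> (\<forall>s \<in> diagram lam. \<not> r dvd hook lam s)"

definition seq01 :: "(nat \<Rightarrow> nat) \<Rightarrow> int \<Rightarrow> nat" where
  "seq01 lam k = (if \<exists>i. k = int (lam i) - int (i + 1) then 0 else 1)"

inductive exchange :: "nat \<Rightarrow> (int \<Rightarrow> nat) \<Rightarrow> (int \<Rightarrow> nat) \<Rightarrow> bool" for r where
  "s k = 1 \<Longrightarrow> s (k + int r) = 0 \<Longrightarrow> exchange r s (s(k := 0, k + int r := 1))"

text \<open>
  For \<open>r > 0\<close> the exchanges terminate and their result does not depend on the order in
  which they are made; it is again the sequence of exactly one partition.
\<close>

definition r_core :: "nat \<Rightarrow> (nat \<Rightarrow> nat) \<Rightarrow> (nat \<Rightarrow> nat)" where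
  "r_core r lam = (THE mu. mu \<in> partitions
     \<and> (exchange r)\<^sup>*\<^sup>* (seq01 lam) (seq01 mu)
     \<and> (\<nexists>s. exchange r (seq01 mu) s))"

text \<open>
  Infinite sums and products of formal power series are taken in the topology given by the
  library metric on \<open>fps\<close>, in which convergence means that every coefficient is
  eventually constant.
\<close>

definition qpoch_inf :: "'a::{t2_space, comm_ring_1} \<Rightarrow> 'a \<Rightarrow> 'a" where
  "qpoch_inf a q = (\<Prod>j. 1 - a * q ^ j)"

definition f_series :: "nat \<Rightarrow> (nat \<Rightarrow> 'a::comm_ring_1) \<Rightarrow> 'a fps" where
  "f_series r \<rho> = (\<Sum>\<^sub>\<infinity>lam\<in>partitions.
     fps_X ^ psize lam * fps_const (\<Prod>h\<in>#bottom_hooks 1 lam. \<rho> (r * h)))"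

text \<open>
  Quotient by a power series with constant coefficient 1. The library division on
  \<open>fps\<close> needs an \<open>inverse\<close> operation on the coefficients, which a
  commutative ring does not have; the second argument of \<open>fps_right_inverse\<close> is
  the inverse of the constant coefficient.
\<close>

definition fps_quot1 :: "'a::comm_ring_1 fps \<Rightarrow> 'a fps \<Rightarrow> 'a fps" where
  "fps_quot1 F G = F * fps_right_inverse G 1"

end

theory Submission
  imports Defs
begin

text \<open>
  A partition is handled through its bead configuration: the zeros of its 0/1-sequence, at the
  positions \<open>lam i - i - 1\<close>. The argument rests on two bijections.

  First, in row \<open>i\<close> the bottom squares have hook-lengths
  \<open>1, \<dots>, lam i - lam (Suc i)\<close>, so the product over the bottom hooks divisible by \<open>r\<close> depends
  only on the quotients of the gaps \<open>lam i - lam (Suc i)\<close> by \<open>r\<close>. Dividing every gap by \<open>r\<close>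
  with remainder writes \<open>lam = r * mu + nu\<close> uniquely, where \<open>mu\<close> is any partition and \<open>nu\<close> is a
  partition with all gaps smaller than \<open>r\<close> (\<open>scale_add_bij\<close>). The product for \<open>lam\<close> is the product
  for \<open>mu\<close> that occurs in \<open>f_series\<close> (\<open>prod_bottom_hooks_scale_add\<close>). Moreover \<open>lam\<close> and \<open>nu\<close>
  have the same \<open>r\<close>-core, because the core depends only on the residues modulo \<open>r\<close> of the
  bead positions, which agree row by row (\<open>r_core_iff\<close>, \<open>charge_scale_add\<close>). Hence the left-hand side is \<open>f_series\<close>
  times a series \<open>R\<close> that does not involve \<open>\<rho>\<close>, namely the generating function of those \<open>nu\<close>
  whose \<open>r\<close>-core is \<open>\<omega>\<close> (\<open>charge_class_factor\<close>).

  Second, \<open>R\<close> is found from the case that \<open>\<rho>\<close> is constantly \<open>1\<close>. Then the left-hand side counts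
  partitions with \<open>r\<close>-core \<open>\<omega>\<close>, which correspond to \<open>r\<close>-tuples of partitions, the \<open>r\<close>-quotients:
  each residue class of positions is a shifted bead configuration of its own, its shift (the
  charge) is prescribed by \<open>\<omega>\<close>, and the size is \<open>\<bar>\<omega>\<bar>\<close> plus \<open>r\<close> times the total size of the tuple
  (\<open>quotient_bij\<close>, \<open>psize_weight\<close>). With \<open>P\<close> the generating function of all partitions this reads
  \<open>P ^ r = P * R\<close>, so \<open>R = P ^ (r - 1)\<close>, and \<open>P\<close> is the inverse of \<open>qpoch_inf fps_X fps_X\<close> by Euler
  (\<open>partition_gf_qpoch\<close>).
\<close>

section \<open>Weighted generating functions\<close>

definition gen_fps :: "'b set \<Rightarrow> ('b \<Rightarrow> nat) \<Rightarrow> ('b \<Rightarrow> 'a::comm_ring_1) \<Rightarrow> 'a fps" where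
  "gen_fps A w c = Abs_fps (\<lambda>n. \<Sum>a | a \<in> A \<and> w a = n. c a)"

definition finite_fibres :: "'b set \<Rightarrow> ('b \<Rightarrow> nat) \<Rightarrow> bool" where
  "finite_fibres A w \<longleftrightarrow> (\<forall>n. finite {a \<in> A. w a = n})"

text \<open>
  Only the finitely many terms of weight \<open>n\<close> contribute to the coefficient of
  \<open>fps_X ^ n\<close>, so this coefficient is the same for all finite partial sums that contain
  them.
\<close>
lemma has_sum_gen_fps:
  fixes c :: "'b \<Rightarrow> 'a::comm_ring_1"
  assumes "finite_fibres A w"
  shows "((\<lambda>a. fps_X ^ w a * fps_const (c a)) has_sum gen_fps A w c) A"
  unfolding has_sum_def
proof (rule tendsto_fpsI)
  fix n
  let ?X = "{a \<in> A. w a = n}"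
  have fin: "finite ?X" using assms by (simp add: finite_fibres_def)
  have nth: "fps_nth (fps_X ^ w a * fps_const (c a)) n = (if w a = n then c a else 0)" for a
    by (simp add: fps_X_power_mult_nth)
  have "fps_nth (\<Sum>a\<in>F. fps_X ^ w a * fps_const (c a)) n = fps_nth (gen_fps A w c) n"
    if "finite F" "?X \<subseteq> F" "F \<subseteq> A" for F
  proof -
    have "fps_nth (\<Sum>a\<in>F. fps_X ^ w a * fps_const (c a)) n = (\<Sum>a\<in>F. if w a = n then c a else 0)"
      by (simp only: fps_sum_nth nth)
    also have "\<dots> = (\<Sum>a | a \<in> F \<and> w a = n. c a)"
      using that by (simp add: sum.inter_filter)
    also have "{a \<in> F. w a = n} = ?X" using that by auto
    finally show ?thesis by (simp add: gen_fps_def)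
  qed
  then show "\<forall>\<^sub>F F in finite_subsets_at_top A.
      fps_nth (\<Sum>a\<in>F. fps_X ^ w a * fps_const (c a)) n = fps_nth (gen_fps A w c) n"
    unfolding eventually_finite_subsets_at_top using fin by (intro exI[of _ ?X]) auto
qed

lemma gen_fps_reindex:
  assumes "bij_betw g B A"
    and "\<And>b. b \<in> B \<Longrightarrow> w (g b) = v b" and "\<And>b. b \<in> B \<Longrightarrow> c (g b) = d b"
  shows "gen_fps A w c = gen_fps B v d"
proof -
  have "(\<Sum>a | a \<in> A \<and> w a = n. c a) = (\<Sum>b | b \<in> B \<and> v b = n. d b)" for n
  proof -
    have "bij_betw g {b \<in> B. v b = n} {a \<in> A. w a = n}"
      using assms(1,2) by (auto simp: bij_betw_def inj_on_def image_iff)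
    then have "(\<Sum>a | a \<in> A \<and> w a = n. c a) = (\<Sum>b | b \<in> B \<and> v b = n. c (g b))"
      by (rule sum.reindex_bij_betw[symmetric])
    also have "\<dots> = (\<Sum>b | b \<in> B \<and> v b = n. d b)"
      using assms(3) by (auto intro: sum.cong)
    finally show ?thesis .
  qed
  then show ?thesis by (simp add: gen_fps_def)
qed

lemma gen_fps_times:
  assumes "finite_fibres A w" "finite_fibres B v"
  shows "gen_fps A w c * gen_fps B v d = gen_fps (A \<times> B) (\<lambda>(a, b). w a + v b) (\<lambda>(a, b). c a * d b)"
proof (rule fps_ext)
  fix n
  let ?A = "\<lambda>i. {a \<in> A. w a = i}" and ?B = "\<lambda>i. {b \<in> B. v b = i}"
  have fin: "finite (?A i)" "finite (?B i)" for i
    using assms by (auto simp: finite_fibres_def)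
  have U: "{p. p \<in> A \<times> B \<and> (case p of (a, b) \<Rightarrow> w a + v b) = n} = (\<Union>i\<in>{0..n}. ?A i \<times> ?B (n - i))"
    by auto
  have "fps_nth (gen_fps A w c * gen_fps B v d) n
      = (\<Sum>i=0..n. \<Sum>(a, b)\<in>?A i \<times> ?B (n - i). c a * d b)"
    by (simp add: fps_mult_nth gen_fps_def sum_product sum.cartesian_product)
  also have "\<dots> = (\<Sum>(a, b)\<in>(\<Union>i\<in>{0..n}. ?A i \<times> ?B (n - i)). c a * d b)"
    by (rule sum.UNION_disjoint[symmetric]) (use fin in auto)
  finally show "fps_nth (gen_fps A w c * gen_fps B v d) n
      = fps_nth (gen_fps (A \<times> B) (\<lambda>(a, b). w a + v b) (\<lambda>(a, b). c a * d b)) n"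
    by (simp add: gen_fps_def U)
qed

lemma finite_fibres_times:
  assumes "finite_fibres A w" "finite_fibres B v"
  shows "finite_fibres (A \<times> B) (\<lambda>(a, b). w a + v b)"
  unfolding finite_fibres_def
proof
  fix n
  have "{p \<in> A \<times> B. (case p of (a, b) \<Rightarrow> w a + v b) = n}
      = (\<Union>i\<in>{0..n}. {a \<in> A. w a = i} \<times> {b \<in> B. v b = n - i})"
    by auto
  then show "finite {p \<in> A \<times> B. (case p of (a, b) \<Rightarrow> w a + v b) = n}"
    using assms by (auto simp: finite_fibres_def)
qed

lemma finite_fibres_inj:
  assumes "finite_fibres A w" "inj_on g B" "\<And>b. b \<in> B \<Longrightarrow> g b \<in> A" "\<And>b. b \<in> B \<Longrightarrow> w (g b) = v b"
  shows "finite_fibres B v"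
  unfolding finite_fibres_def
proof
  fix n
  have "g ` {b \<in> B. v b = n} \<subseteq> {a \<in> A. w a = n}" using assms(3,4) by auto
  then have "finite (g ` {b \<in> B. v b = n})"
    using assms(1) unfolding finite_fibres_def by (rule_tac finite_subset) auto
  then show "finite {b \<in> B. v b = n}"
    by (rule finite_imageD) (use assms(2) in \<open>auto simp: inj_on_def\<close>)
qed

text \<open>
  The power \<open>partition_gf ^ r\<close> counts \<open>r\<close>-tuples of partitions. Tuples are taken in
  \<open>PiE\<close>, so that they form a set with finite fibres. Finiteness and the formula are
  proved in one induction, since the product rule for generating functions needs both
  factors to have finite fibres.
\<close>
lemma gen_fps_PiE:
  assumes "finite_fibres A w"
  shows "finite_fibres (PiE {..<r} (\<lambda>_. A)) (\<lambda>f. \<Sum>i<r. w (f i)) \<and>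
    gen_fps (PiE {..<r} (\<lambda>_. A)) (\<lambda>f. \<Sum>i<r. w (f i)) (\<lambda>_. 1 :: 'a::comm_ring_1)
      = gen_fps A w (\<lambda>_. 1) ^ r"
proof (induction r)
  case 0
  have "gen_fps {\<lambda>_. undefined} (\<lambda>_. 0) (\<lambda>_. 1 :: 'a) = 1"
    by (rule fps_ext) (auto simp: gen_fps_def)
  then show ?case by (auto simp: finite_fibres_def)
next
  case (Suc r)
  let ?P = "\<lambda>r. PiE {..<r} (\<lambda>_. A)" and ?w = "\<lambda>r f. \<Sum>i<r. w (f i)"
  let ?g = "\<lambda>(x, f). f(r := x)"
  have inj: "inj_on ?g (A \<times> ?P r)"
    unfolding lessThan_Suc by (rule inj_combinator) simp
  have img: "?g ` (A \<times> ?P r) = ?P (Suc r)"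
    unfolding lessThan_Suc PiE_insert_eq by simp
  have bij: "bij_betw ?g (A \<times> ?P r) (?P (Suc r))"
    using inj img by (simp add: bij_betw_def)
  have w: "?w (Suc r) (?g p) = (case p of (x, f) \<Rightarrow> w x + ?w r f)" if "p \<in> A \<times> ?P r" for p
    by (auto simp: algebra_simps split: prod.split)
  have "gen_fps (?P (Suc r)) (?w (Suc r)) (\<lambda>_. 1 :: 'a)
      = gen_fps (A \<times> ?P r) (\<lambda>(x, f). w x + ?w r f) (\<lambda>(x, f). 1 * 1)"
    by (rule gen_fps_reindex[OF bij]) (simp_all only: w, simp add: case_prod_beta)
  also have "\<dots> = gen_fps A w (\<lambda>_. 1) * gen_fps (?P r) (?w r) (\<lambda>_. 1)"
    by (rule gen_fps_times[symmetric]) (use assms Suc in auto)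
  finally have eq: "gen_fps (?P (Suc r)) (?w (Suc r)) (\<lambda>_. 1 :: 'a) = gen_fps A w (\<lambda>_. 1) ^ Suc r"
    using Suc by simp
  have "finite_fibres (?P (Suc r)) (?w (Suc r))"
  proof (rule finite_fibres_inj[OF finite_fibres_times[OF assms conjunct1[OF Suc]]])
    let ?h = "inv_into (A \<times> ?P r) ?g"
    show "inj_on ?h (?P (Suc r))" using img by (simp add: inj_on_inv_into)
    show "?h b \<in> A \<times> ?P r" if "b \<in> ?P (Suc r)" for b
      using that img inv_into_into[of b ?g "A \<times> ?P r"] by blast
    then show "(case ?h b of (x, f) \<Rightarrow> w x + ?w r f) = ?w (Suc r) b" if "b \<in> ?P (Suc r)" for b
      using that img w[of "?h b"] f_inv_into_f[of b ?g "A \<times> ?P r"] by metis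
  qed
  then show ?case using eq by blast
qed

section \<open>Partitions and Euler's product\<close>

lemma partition_eventually_0:
  assumes "lam \<in> partitions" obtains N where "lam N = 0"
proof -
  have "finite {i. lam i \<noteq> 0}" using assms by (simp add: partitions_def)
  then have "{i. lam i \<noteq> 0} \<noteq> UNIV" using infinite_UNIV_nat by metis
  then show ?thesis using that by auto
qed

lemma partition_antimono: "lam \<in> partitions \<Longrightarrow> i \<le> j \<Longrightarrow> lam j \<le> lam i"
  by (simp add: partitions_def decseq_def)

lemma partition_zero_mono: "lam \<in> partitions \<Longrightarrow> lam N = 0 \<Longrightarrow> N \<le> j \<Longrightarrow> lam j = 0"
  by (metis partition_antimono le_zero_eq)

lemma partitionI:
  assumes "\<And>i. lam (Suc i) \<le> lam i" "lam N = 0"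
  shows "lam \<in> partitions"
proof -
  have d: "decseq lam" using assms(1) by (rule decseq_SucI)
  have "{i. lam i \<noteq> 0} \<subseteq> {..<N}"
    using decseqD[OF d, of N] assms(2) by (auto simp: not_less[symmetric]) (metis not_less le_zero_eq neq0_conv)
  then show ?thesis using d finite_subset by (auto simp: partitions_def)
qed

lemma psize_eq:
  assumes "lam \<in> partitions" "lam N = 0"
  shows "psize lam = (\<Sum>i<N. lam i)"
  unfolding psize_def
  by (rule sum.mono_neutral_left) (use partition_zero_mono[OF assms] not_less in auto)

lemma partition_le_psize:
  assumes "lam \<in> partitions" shows "lam i \<le> psize lam"
proof -
  obtain N where "lam N = 0" using assms by (rule partition_eventually_0)
  then have "lam (max N (Suc i)) = 0" using assms partition_zero_mono by fastforce
  from psize_eq[OF assms this] show ?thesis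
    using member_le_sum[of i "{..<max N (Suc i)}" lam] by simp
qed

lemma partition_zero_psize:
  assumes "lam \<in> partitions" "psize lam \<le> n" shows "lam n = 0"
proof (rule ccontr)
  assume n: "lam n \<noteq> 0"
  obtain N where N: "lam N = 0" using assms by (auto elim: partition_eventually_0)
  have "n < N" using N n partition_zero_mono[OF assms(1) N] not_less by blast
  have "Suc n = (\<Sum>i<Suc n. 1)" by simp
  also have "\<dots> \<le> (\<Sum>i<Suc n. lam i)"
    using n partition_antimono[OF assms(1), of _ n] by (intro sum_mono) (metis Suc_leI lessThan_iff less_Suc_eq_le One_nat_def neq0_conv le_zero_eq)
  also have "\<dots> \<le> (\<Sum>i<N. lam i)" using \<open>n < N\<close> by (intro sum_mono2) auto
  finally show False using assms(2) psize_eq[OF assms(1) N] by simp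
qed

lemma finite_fibres_partitions: "finite_fibres partitions psize"
  unfolding finite_fibres_def
proof
  fix n
  have "{lam \<in> partitions. psize lam = n}
      \<subseteq> {f. \<forall>x. (x \<in> {..<n} \<longrightarrow> f x \<in> {..n}) \<and> (x \<notin> {..<n} \<longrightarrow> f x = 0)}"
    using partition_le_psize partition_zero_psize by (auto simp: not_less)
  moreover have "finite \<dots>" by (rule finite_set_of_finite_funs) auto
  ultimately show "finite {lam \<in> partitions. psize lam = n}" by (rule finite_subset)
qed

lemma finite_fibres_subset: "finite_fibres A w \<Longrightarrow> B \<subseteq> A \<Longrightarrow> finite_fibres B w"
  by (rule finite_fibres_inj[where g="\<lambda>x. x" and A=A and w=w]) auto

abbreviation partition_gf :: "'a::comm_ring_1 fps" where
  "partition_gf \<equiv> gen_fps partitions psize (\<lambda>_. 1)"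

text \<open>
  Adding one box to each of the first \<open>m\<close> rows: the bijection behind the recursion for
  partitions with a bounded number of rows.
\<close>
lemma add_column_partition:
  assumes "lam \<in> partitions" "lam m = 0"
  defines "mu \<equiv> \<lambda>i. if i < m then lam i + 1 else 0"
  shows "mu \<in> partitions" "psize mu = m + psize lam"
proof -
  show mu: "mu \<in> partitions"
    by (rule partitionI[where N=m]) (use partition_antimono[OF assms(1)] in \<open>auto simp: mu_def\<close>)
  have "psize mu = (\<Sum>i<m. mu i)" by (rule psize_eq[OF mu]) (simp add: mu_def)
  also have "\<dots> = m + psize lam"
    using psize_eq[OF assms(1,2)] by (simp add: mu_def sum.distrib del: One_nat_def Suc_eq_plus1 add_Suc_right)
  finally show "psize mu = m + psize lam" .
qed

text \<open>
  Partitions with at most \<open>m + 1\<close> rows either have at most \<open>m\<close> rows, or arise from a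
  partition with at most \<open>m + 1\<close> rows by adding a first column of length \<open>m + 1\<close>. So the
  generating function satisfies \<open>P (m + 1) * (1 - X ^ (m + 1)) = P m\<close>.
\<close>
lemma bounded_length_gf:
  "gen_fps {lam \<in> partitions. lam m = 0} psize (\<lambda>_. 1) * (\<Prod>k<m. 1 - fps_X ^ Suc k) = (1 :: 'a::comm_ring_1 fps)"
proof (induction m)
  case 0
  have "{lam \<in> partitions. lam 0 = 0} = {\<lambda>_. 0}"
  proof -
    have "lam = (\<lambda>_. 0)" if "lam \<in> partitions" "lam 0 = 0" for lam
      using partition_zero_mono[OF that] by auto
    then show ?thesis by (auto intro: partitionI)
  qed
  moreover have "psize (\<lambda>_. 0) = 0" by (simp add: psize_def)
  ultimately have "gen_fps {lam \<in> partitions. lam 0 = 0} psize (\<lambda>_. 1) = (1 :: 'a fps)"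
    by (intro fps_ext) (auto simp: gen_fps_def Collect_conv_if cong: conj_cong)
  then show ?case by simp
next
  case (Suc m)
  let ?Q = "\<lambda>m. {lam \<in> partitions. lam m = 0}"
  let ?P = "\<lambda>m. gen_fps (?Q m) psize (\<lambda>_. 1 :: 'a)"
  let ?E = "{lam \<in> partitions. lam (Suc m) = 0 \<and> lam m \<noteq> 0}"
  \<comment> \<open>Adds a column of length \<open>m + 1\<close>; its inverse subtracts \<open>1\<close> from every part, with \<open>0 - 1 = 0\<close> on the zero parts.\<close>
  let ?g = "\<lambda>lam i. if i < Suc m then lam i + 1 else (0::nat)"
  have bij: "bij_betw ?g (?Q (Suc m)) ?E"
  proof (rule bij_betw_byWitness[where f'="\<lambda>lam i. lam i - 1"])
    show "\<forall>a\<in>?Q (Suc m). (\<lambda>i. ?g a i - 1) = a"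
      by (auto simp: partition_zero_mono not_less)
    have "?g (\<lambda>i. a i - 1) i = a i" if "a \<in> ?E" for a i
      using that partition_antimono[of a i m] partition_zero_mono[of a "Suc m" i] by auto
    then show "\<forall>a\<in>?E. ?g (\<lambda>i. a i - 1) = a" by blast
    show "?g ` ?Q (Suc m) \<subseteq> ?E" using add_column_partition(1) by auto
    have Q: "(\<lambda>i. a i - 1) \<in> ?Q (Suc m)" if "a \<in> ?E" for a
    proof -
      have "a (Suc i) - 1 \<le> a i - 1" for i
        using that partition_antimono[of a i "Suc i"] by (simp add: diff_le_mono)
      then show ?thesis using that partitionI[of "\<lambda>i. a i - 1" "Suc m"] by simp
    qed
    show "(\<lambda>lam i. lam i - 1) ` ?E \<subseteq> ?Q (Suc m)" by (rule image_subsetI, rule Q)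
  qed
  have "gen_fps ?E psize (\<lambda>_. 1 :: 'a) = gen_fps (?Q (Suc m)) (\<lambda>lam. Suc m + psize lam) (\<lambda>_. 1)"
    by (rule gen_fps_reindex[OF bij]) (use add_column_partition(2) in auto)
  also have "\<dots> = fps_X ^ Suc m * ?P (Suc m)"
  proof (rule fps_ext)
    fix n
    have "{a. a \<in> ?Q (Suc m) \<and> Suc m + psize a = n}
        = (if n < Suc m then {} else {a. a \<in> ?Q (Suc m) \<and> psize a = n - Suc m})"
      by auto
    then show "fps_nth (gen_fps (?Q (Suc m)) (\<lambda>lam. Suc m + psize lam) (\<lambda>_. 1 :: 'a)) n
        = fps_nth (fps_X ^ Suc m * ?P (Suc m)) n"
      by (simp only: gen_fps_def fps_X_power_mult_nth fps_nth_Abs_fps) simp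
  qed
  finally have E: "gen_fps ?E psize (\<lambda>_. 1 :: 'a) = fps_X ^ Suc m * ?P (Suc m)" .
  have "?P (Suc m) = ?P m + gen_fps ?E psize (\<lambda>_. 1)"
  proof (rule fps_ext)
    fix n
    have fin: "finite {lam \<in> partitions. psize lam = n}"
      using finite_fibres_partitions by (simp add: finite_fibres_def)
    have U: "{a. a \<in> ?Q (Suc m) \<and> psize a = n}
        = {a. a \<in> ?Q m \<and> psize a = n} \<union> {a. a \<in> ?E \<and> psize a = n}"
      using partition_zero_mono[of _ m "Suc m"] by auto
    show "fps_nth (?P (Suc m)) n = fps_nth (?P m + gen_fps ?E psize (\<lambda>_. 1)) n"
      unfolding gen_fps_def fps_nth_Abs_fps fps_add_nth U
    proof (rule sum.union_disjoint)
      show "finite {a. a \<in> ?Q m \<and> psize a = n}" by (rule finite_subset[OF _ fin]) auto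
      show "finite {a. a \<in> ?E \<and> psize a = n}" by (rule finite_subset[OF _ fin]) auto
    qed auto
  qed
  then have split: "?P (Suc m) = ?P m + fps_X ^ Suc m * ?P (Suc m)" unfolding E .
  have "?P (Suc m) * (1 - fps_X ^ Suc m) = ?P (Suc m) - fps_X ^ Suc m * ?P (Suc m)"
    by (simp only: mult.commute[of "?P (Suc m)"] left_diff_distrib mult_1_left)
  also have "\<dots> = ?P m" unfolding diff_eq_eq by (rule split)
  finally have step: "?P (Suc m) * (1 - fps_X ^ Suc m) = ?P m" .
  have "?P (Suc m) * (\<Prod>k<Suc m. 1 - fps_X ^ Suc k)
      = ?P (Suc m) * (1 - fps_X ^ Suc m) * (\<Prod>k<m. 1 - fps_X ^ Suc k)"
    by (simp only: prod.lessThan_Suc ac_simps)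
  then show ?case unfolding step Suc .
qed

text \<open>
  Euler's product formula. The coefficient of \<open>fps_X ^ n\<close>, in the generating function as
  in the product, no longer changes once \<open>n\<close> rows, respectively \<open>n\<close> factors, are
  admitted, so the finite versions determine it.
\<close>
lemma partition_gf_qpoch: "partition_gf * qpoch_inf fps_X fps_X = (1 :: 'a::comm_ring_1 fps)"
proof -
  let ?D = "\<lambda>m. \<Prod>k<m. 1 - fps_X ^ Suc k :: 'a fps"
  define Q where "Q = Abs_fps (\<lambda>n. fps_nth (?D n) n)"
  have stable: "fps_nth (?D m) n = fps_nth Q n" if "n \<le> m" for n m
    using that
  proof (induction m rule: dec_induct)
    case base then show ?case by (simp add: Q_def)
  next
    case (step m)
    have "?D (Suc m) = ?D m - ?D m * fps_X ^ Suc m" by (simp add: algebra_simps del: power_Suc)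
    then show ?case using step by (simp add: fps_X_power_mult_right_nth del: power_Suc)
  qed
  have PQ: "partition_gf * Q = 1"
  proof (rule fps_ext)
    fix n
    let ?P = "gen_fps {lam \<in> partitions. lam n = 0} psize (\<lambda>_. 1 :: 'a)"
    have "fps_nth (partition_gf :: 'a fps) k = fps_nth ?P k" if "k \<le> n" for k
      using that partition_zero_psize
      by (simp only: gen_fps_def fps_nth_Abs_fps) (intro sum.cong, auto)
    moreover have "fps_nth Q k = fps_nth (?D n) k" if "k \<le> n" for k
      using stable[OF that] by simp
    ultimately have "fps_nth (partition_gf * Q) n = fps_nth (?P * ?D n) n"
      by (auto simp: fps_mult_nth intro!: sum.cong)
    then show "fps_nth (partition_gf * Q) n = fps_nth 1 n"
      unfolding bounded_length_gf .
  qed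
  have "(\<lambda>n. \<Prod>i\<le>n. 1 - fps_X * fps_X ^ i :: 'a fps) \<longlonglongrightarrow> Q"
  proof (rule tendsto_fpsI)
    fix n
    have "fps_nth (\<Prod>i\<le>m. 1 - fps_X * fps_X ^ i :: 'a fps) n = fps_nth Q n" if "n \<le> m" for m
      using stable[of n "Suc m"] that by (simp only: lessThan_Suc_atMost power_Suc le_SucI)
    then show "\<forall>\<^sub>F m in sequentially. fps_nth (\<Prod>i\<le>m. 1 - fps_X * fps_X ^ i :: 'a fps) n = fps_nth Q n"
      unfolding eventually_sequentially by blast
  qed
  moreover have "Q \<noteq> 0" using PQ by auto
  ultimately have raw: "raw_has_prod (\<lambda>i. 1 - fps_X * fps_X ^ i :: 'a fps) 0 Q"
    by (simp add: raw_has_prod_def)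
  \<comment> \<open>The definition of \<open>has_prod\<close> treats products with a zero factor separately; that case does not arise.\<close>
  have factor: "1 - fps_X * fps_X ^ i \<noteq> (0 :: 'a fps)" for i
  proof
    assume "1 - fps_X * fps_X ^ i = (0 :: 'a fps)"
    then have "fps_nth (1 - fps_X * fps_X ^ i :: 'a fps) 0 = 0" by simp
    then show False by simp
  qed
  have "qpoch_inf fps_X fps_X = Q"
    unfolding qpoch_inf_def prodinf_def
  proof (rule the_equality)
    show "(\<lambda>j. 1 - fps_X * fps_X ^ j) has_prod Q" using raw by (simp add: has_prod_def)
    fix p :: "'a fps" assume "(\<lambda>j. 1 - fps_X * fps_X ^ j) has_prod p"
    then show "p = Q" using raw factor LIMSEQ_unique by (auto simp: has_prod_def raw_has_prod_def)
  qed
  then show ?thesis using PQ by simp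
qed

section \<open>Bead configurations\<close>

text \<open>
  With \<open>c = 0\<close> these are the positions of the zeros in the 0/1-sequence of \<open>lam\<close>; the
  integer \<open>c\<close> shifts the whole configuration and is its charge.
\<close>
definition bead :: "int \<Rightarrow> (nat \<Rightarrow> nat) \<Rightarrow> nat \<Rightarrow> int" where
  "bead c lam i = c + int (lam i) - int (Suc i)"

definition beads :: "int \<Rightarrow> (nat \<Rightarrow> nat) \<Rightarrow> int set" where
  "beads c lam = range (bead c lam)"

lemma bead_less: "lam \<in> partitions \<Longrightarrow> i < j \<Longrightarrow> bead c lam j < bead c lam i"
  using partition_antimono[of lam i j] by (simp add: bead_def)

lemma bead_less_iff: "lam \<in> partitions \<Longrightarrow> bead c lam j < bead c lam i \<longleftrightarrow> i < j"
  by (metis bead_less linorder_neqE_nat order_less_asym)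

lemma bead_inj: "lam \<in> partitions \<Longrightarrow> inj (bead c lam)"
  by (metis bead_less injI linorder_neqE_nat order_less_irrefl)

text \<open>
  Beyond the last nonzero part the beads fill every position, so a bead configuration is
  a half-line together with finitely many further beads.
\<close>
lemma beads_split:
  assumes "lam \<in> partitions" "lam N = 0"
  shows "beads c lam = {..<c - int N} \<union> bead c lam ` {..<N}"
proof -
  have zero: "bead c lam i = c - int (Suc i)" if "N \<le> i" for i
    using partition_zero_mono[OF assms that] by (simp add: bead_def)
  have "bead c lam ` {N..} = {..<c - int N}"
  proof (intro equalityI subsetI)
    fix k assume "k \<in> {..<c - int N}"
    then have N: "N \<le> nat (c - k - 1)" and "k < c" by auto
    then have "k = bead c lam (nat (c - k - 1))" using zero[OF N] by simp
    with N show "k \<in> bead c lam ` {N..}" by blast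
  qed (auto simp: zero)
  moreover have "UNIV = {N..} \<union> {..<N}" by auto
  ultimately show ?thesis unfolding beads_def by (metis image_Un)
qed

lemma beads_upper: "lam \<in> partitions \<Longrightarrow> beads c lam \<subseteq> {..bead c lam 0}"
  using bead_less_iff[of lam c 0] by (auto simp: beads_def not_less[symmetric])

lemma beads_lower: "lam \<in> partitions \<Longrightarrow> \<exists>L. {..<L} \<subseteq> beads c lam"
  using beads_split partition_eventually_0 by (metis Un_upper1)

text \<open>
  The value \<open>f n\<close> is the largest element of the range after \<open>f 0, \<dots>, f (n - 1)\<close>
  are removed.
\<close>
lemma antimono_range_unique:
  fixes f g :: "nat \<Rightarrow> int"
  assumes "\<And>i j. f j < f i \<longleftrightarrow> i < j" "\<And>i j. g j < g i \<longleftrightarrow> i < j" "range f = range g"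
  shows "f = g"
proof
  fix n show "f n = g n"
  proof (induction n rule: less_induct)
    case (less n)
    obtain m where m: "f n = g m" using assms(3) by (metis rangeE rangeI)
    obtain l where l: "g n = f l" using assms(3) by (metis rangeE rangeI)
    have "n \<le> m" using less[of m] assms(1)[of n m] m by (metis not_less order_less_irrefl)
    moreover have "n \<le> l" using less[of l] assms(2)[of n l] l by (metis not_less order_less_irrefl)
    ultimately show ?case using assms(1)[of n l] assms(2)[of n m] m l
      by (metis less_le not_less_iff_gr_or_eq order_less_asym)
  qed
qed

lemma beads_unique:
  assumes "lam \<in> partitions" "mu \<in> partitions" "beads c lam = beads d mu"
  shows "c = d" "lam = mu"
proof -
  have eq: "bead c lam = bead d mu"
    using assms by (intro antimono_range_unique) (auto simp: bead_less_iff beads_def)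
  obtain N N' where "lam N = 0" "mu N' = 0"
    using assms(1,2) by (metis partition_eventually_0)
  then have "lam (max N N') = 0" "mu (max N N') = 0"
    using assms(1,2) by (auto intro: partition_zero_mono)
  then show "c = d" using fun_cong[OF eq, of "max N N'"] by (simp add: bead_def)
  then show "lam = mu" using eq by (auto simp: bead_def fun_eq_iff)
qed

text \<open>
  Every set of integers that is bounded above and contains a half-line to the left is a
  bead configuration: list its elements in decreasing order as \<open>f\<close>; then \<open>f i + i\<close>
  decreases weakly and is eventually constant, and its excess over the final value is
  the partition.
\<close>
lemma beads_exist:
  assumes "{..<L} \<subseteq> M" "M \<subseteq> {..U}"
  obtains c lam where "lam \<in> partitions" "M = beads c lam"
proof -
  define A where "A = {k::nat. U - int k \<in> M}"
  have "{Suc (nat (U - L))..} \<subseteq> A" using assms(1) by (auto simp: A_def)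
  then have inf: "infinite A" using infinite_Ici infinite_super by blast
  define f where "f i = U - int (enumerate A i)" for i
  have range: "range f = M"
  proof (intro equalityI subsetI)
    fix k assume "k \<in> range f"
    then show "k \<in> M" using enumerate_in_set[OF inf] by (auto simp: f_def A_def)
  next
    fix k assume k: "k \<in> M"
    then have kU: "k \<le> U" using assms(2) by auto
    then have "nat (U - k) \<in> A" using k by (simp add: A_def)
    then obtain i where "enumerate A i = nat (U - k)" using enumerate_Ex[OF inf] by blast
    then have "f i = k" using kU by (simp add: f_def)
    then show "k \<in> range f" by blast
  qed
  have less: "f j < f i" if "i < j" for i j
    using enumerate_mono[OF that inf] by (simp add: f_def)
  have less': "i < j" if "f j < f i" for i j
    using that less by (metis linorder_neqE_nat order_less_asym order_less_irrefl)
  have anti: "f j + int j \<le> f i + int i" if "i \<le> j" for i j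
    using that
  proof (induction rule: dec_induct)
    case (step j)
    then show ?case using less[of j "Suc j"] by simp
  qed simp
  \<comment> \<open>From \<open>N\<close> on, \<open>f\<close> takes its values in the half-line, where it descends in steps of \<open>1\<close>.\<close>
  define N where "N = Suc (nat (U - L))"
  have fN: "f i < L" if "N \<le> i" for i
    using le_enumerate[OF inf, of i] that by (simp add: f_def N_def)
  have step: "f (Suc i) = f i - 1" if i: "N \<le> i" for i
  proof -
    have "f i - 1 \<in> M" using fN[OF i] assms(1) by auto
    then obtain j where j: "f j = f i - 1" using range by (metis imageE)
    then have "Suc i \<le> j" using less'[of j i] by simp
    then have "f j \<le> f (Suc i)" using less by (cases "j = Suc i") (auto simp: le_less)
    then show ?thesis using j less[of i "Suc i"] by simp
  qed
  have const: "f i + int i = f N + int N" if "N \<le> i" for i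
    using that by (induction rule: dec_induct) (simp_all add: step)
  define c where "c = f N + int N + 1"
  define lam where "lam i = nat (f i + int i + 1 - c)" for i
  have ge: "f i + int i + 1 \<ge> c" for i
    using anti[of i N] const[of i] by (cases "i \<le> N") (simp_all add: c_def)
  have "lam \<in> partitions"
  proof (rule partitionI)
    show "lam (Suc i) \<le> lam i" for i using anti[of i "Suc i"] by (simp add: lam_def)
    show "lam N = 0" by (simp add: lam_def c_def)
  qed
  moreover have "bead c lam = f" using ge by (auto simp: bead_def lam_def)
  then have "M = beads c lam" using range by (simp add: beads_def)
  ultimately show thesis by (rule that)
qed

text \<open>
  Moving one bead one step to the left removes one box and leaves the charge alone:
  since the position \<open>b\<close> is free, the row of the bead at \<open>b + 1\<close> is longer than the next
  row and can lose its last box.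
\<close>
lemma beads_move:
  assumes "lam \<in> partitions" "b \<notin> beads c lam" "b + 1 \<in> beads c lam"
  obtains mu where "mu \<in> partitions" "insert b (beads c lam - {b + 1}) = beads c mu"
    "psize lam = Suc (psize mu)"
proof -
  obtain i where i: "b + 1 = bead c lam i" using assms(3) by (auto simp: beads_def)
  have "bead c lam (Suc i) < b + 1" using i bead_less[OF assms(1), of i "Suc i" c] by simp
  moreover have "bead c lam (Suc i) \<noteq> b" using assms(2) by (auto simp: beads_def)
  ultimately have "bead c lam (Suc i) < b" by simp
  then have lt: "lam (Suc i) < lam i" using i by (simp add: bead_def)
  define mu where "mu = lam(i := lam i - 1)"
  obtain N where "lam N = 0" using assms(1) by (rule partition_eventually_0)
  then have N: "lam (max N (Suc i)) = 0" "i < max N (Suc i)"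
    using partition_zero_mono[OF assms(1)] by auto
  then have muN: "mu (max N (Suc i)) = 0" by (simp add: mu_def)
  have mu: "mu \<in> partitions"
  proof (rule partitionI[where N="max N (Suc i)"])
    show "mu (max N (Suc i)) = 0" by (rule muN)
    show "mu (Suc j) \<le> mu j" for j
      using lt partition_antimono[OF assms(1), of j "Suc j"] by (auto simp: mu_def)
  qed
  have bead: "bead c mu j = (if j = i then b else bead c lam j)" for j
    using i lt by (auto simp: bead_def mu_def)
  have "bead c lam j \<noteq> b + 1" if "j \<noteq> i" for j
    using bead_inj[OF assms(1), of c] that i by (metis injD)
  then have "insert b (beads c lam - {b + 1}) = beads c mu"
    using i by (auto simp: beads_def bead image_iff split: if_splits)
  moreover have "(\<Sum>j<max N (Suc i). lam j) = Suc (\<Sum>j<max N (Suc i). mu j)"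
    using lt N by (simp add: mu_def sum.remove[of "{..<max N (Suc i)}" i])
  then have "psize lam = Suc (psize mu)"
    using psize_eq[OF assms(1) N(1)] psize_eq[OF mu muN] by simp
  ultimately show thesis using mu that by blast
qed

text \<open>
  If the position just left of each bead carries a bead, then that bead is the next one,
  so no part is larger than its successor.
\<close>
lemma beads_downclosed:
  assumes "lam \<in> partitions" "\<And>b. b + 1 \<in> beads c lam \<Longrightarrow> b \<in> beads c lam"
  shows "lam = (\<lambda>_. 0)"
proof -
  have "lam i \<le> lam (Suc i)" for i
  proof -
    have "bead c lam i - 1 \<in> beads c lam" by (rule assms(2)) (simp add: beads_def)
    then obtain j where j: "bead c lam i - 1 = bead c lam j" by (auto simp: beads_def)
    then have "i < j" using bead_less_iff[OF assms(1), of c j i] by simp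
    then have "bead c lam j \<le> bead c lam (Suc i)"
      using bead_less[OF assms(1), of "Suc i" j c] by (cases "j = Suc i") auto
    then show ?thesis using j by (simp add: bead_def)
  qed
  then have "mono lam" by (simp add: mono_iff_le_Suc)
  moreover obtain N where "lam N = 0" using assms(1) by (rule partition_eventually_0)
  ultimately have "lam i = 0" for i
    using partition_zero_mono[OF assms(1), of N i] monoD[of lam i N] by (cases "i \<le> N") simp_all
  then show ?thesis by auto
qed

lemma zero_partition: "(\<lambda>_. 0) \<in> partitions" "psize (\<lambda>_. 0) = 0"
  by (auto simp: psize_def intro: partitionI)

lemma psize_zero_iff:
  assumes "lam \<in> partitions" shows "psize lam = 0 \<longleftrightarrow> lam = (\<lambda>_. 0)"
proof
  assume "psize lam = 0"
  then show "lam = (\<lambda>_. 0)" using partition_le_psize[OF assms] by auto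
qed (simp add: zero_partition)

text \<open>
  Beads fill all positions left of the cut-off \<open>- K\<close>, so that infinite counts of beads
  may be replaced by finite counts from the cut-off on.
\<close>
definition deep :: "nat \<Rightarrow> int \<Rightarrow> (nat \<Rightarrow> nat) \<Rightarrow> bool" where
  "deep K c lam \<longleftrightarrow> - int K \<le> c \<and> lam (nat (c + int K)) = 0"

text \<open>
  The sum of the bead positions from \<open>- K\<close> on for the empty partition with charge \<open>c\<close>.
\<close>
definition vacuum :: "nat \<Rightarrow> int \<Rightarrow> int" where
  "vacuum K c = (\<Sum>i<nat (c + int K). c - int (Suc i))"

lemma deep_mono: "lam \<in> partitions \<Longrightarrow> deep K c lam \<Longrightarrow> K \<le> K' \<Longrightarrow> deep K' c lam"
  by (auto simp: deep_def intro: partition_zero_mono)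

lemma deep_exists: assumes "lam \<in> partitions" shows "\<exists>K. deep K c lam"
proof -
  obtain N where N: "lam N = 0" using assms by (rule partition_eventually_0)
  have "deep (N + nat \<bar>c\<bar>) c lam"
    unfolding deep_def by (auto intro!: partition_zero_mono[OF assms N])
  then show ?thesis by blast
qed

text \<open>
  Above a deep cut-off, the number of beads gives the charge and the sum of their
  positions gives the size, up to a constant depending on charge and cut-off only.
\<close>
lemma beads_trunc:
  assumes "lam \<in> partitions" "deep K c lam"
  defines "T \<equiv> beads c lam \<inter> {- int K..}"
  shows "finite T" "int (card T) = c + int K" "\<Sum>T = int (psize lam) + vacuum K c"
proof -
  let ?N = "nat (c + int K)"
  have N: "lam ?N = 0" "c - int ?N = - int K" using assms(2) by (auto simp: deep_def)
  have "bead c lam i \<ge> - int K" if "i < ?N" for i using that by (simp add: bead_def)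
  then have T: "T = bead c lam ` {..<?N}"
    unfolding T_def beads_split[OF assms(1) N(1)] N(2) by auto
  have inj: "inj_on (bead c lam) {..<?N}" using bead_inj[OF assms(1)] by (rule inj_on_subset) simp
  show "finite T" by (simp add: T)
  show "int (card T) = c + int K" using N(2) by (simp add: T card_image[OF inj])
  have "\<Sum>T = (\<Sum>i<?N. int (lam i) + (c - int (Suc i)))"
    by (simp only: T sum.reindex[OF inj] o_def bead_def) (simp add: algebra_simps)
  then show "\<Sum>T = int (psize lam) + vacuum K c"
    by (simp add: psize_eq[OF assms(1) N(1)] vacuum_def sum.distrib sum_subtractf)
qed

section \<open>The runners of the abacus and the r-quotient\<close>

text \<open>
  The subsequence of \<open>M\<close> in the residue class of \<open>a\<close>, that is, one runner of the abacus.
\<close>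
definition runner :: "nat \<Rightarrow> nat \<Rightarrow> int set \<Rightarrow> int set" where
  "runner r a M = {j. int a + int r * j \<in> M}"

lemma residue_unique:
  assumes "a < r" "a' < r" "int a + int r * j = int a' + int r * j'"
  shows "a = a'" "j = j'"
proof -
  have "(int a + int r * j) mod int r = int a" "(int a' + int r * j') mod int r = int a'"
    using assms(1,2) by simp_all
  then show "a = a'" using assms(3) by (metis of_nat_eq_iff)
  then show "j = j'" using assms by simp
qed

lemma residue_exists:
  assumes "r > 0" obtains a j where "a < r" "k = int a + int r * j"
proof
  show "nat (k mod int r) < r" using assms by (simp add: nat_less_iff)
  show "k = int (nat (k mod int r)) + int r * (k div int r)" using assms by simp
qed

lemma runner_ext:
  assumes "r > 0" "\<And>a. a < r \<Longrightarrow> runner r a M = runner r a M'"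
  shows "M = M'"
proof -
  have "k \<in> M \<longleftrightarrow> k \<in> M'" for k
  proof -
    obtain a j where aj: "a < r" "k = int a + int r * j" using assms(1) by (rule residue_exists)
    then have "j \<in> runner r a M \<longleftrightarrow> j \<in> runner r a M'" using assms(2) by simp
    then show ?thesis by (simp add: runner_def aj(2))
  qed
  then show ?thesis by auto
qed

lemma runners_trunc:
  assumes "r > 0"
  shows "M \<inter> {- int (r * K)..} = (\<Union>a<r. (\<lambda>j. int a + int r * j) ` (runner r a M \<inter> {- int K..}))"
proof (intro equalityI subsetI)
  fix k assume k: "k \<in> M \<inter> {- int (r * K)..}"
  obtain a j where aj: "a < r" "k = int a + int r * j" using assms by (rule residue_exists)
  have "0 \<le> int r * (j + int K) + int a" using k aj by (simp add: algebra_simps)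
  then have "0 \<le> (int r * (j + int K) + int a) div int r"
    using assms by (subst pos_imp_zdiv_nonneg_iff) auto
  also have "\<dots> = j + int K" using assms aj(1) by simp
  finally have "j \<in> runner r a M \<inter> {- int K..}" using k aj by (simp add: runner_def)
  then show "k \<in> (\<Union>a<r. (\<lambda>j. int a + int r * j) ` (runner r a M \<inter> {- int K..}))"
    using aj by blast
next
  fix k assume "k \<in> (\<Union>a<r. (\<lambda>j. int a + int r * j) ` (runner r a M \<inter> {- int K..}))"
  then obtain a j where aj: "a < r" "k = int a + int r * j" "j \<in> runner r a M" "- int K \<le> j" by auto
  have "int r * (- int K) \<le> int r * j" using aj(4) by (intro mult_left_mono) auto
  then show "k \<in> M \<inter> {- int (r * K)..}" using aj by (simp add: runner_def)
qed

lemma sum_runners: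
  fixes g :: "int \<Rightarrow> int"
  assumes "r > 0" "\<And>a. a < r \<Longrightarrow> finite (runner r a M \<inter> {- int K..})"
  shows "sum g (M \<inter> {- int (r * K)..})
    = (\<Sum>a<r. \<Sum>j\<in>runner r a M \<inter> {- int K..}. g (int a + int r * j))"
proof -
  have "sum g (M \<inter> {- int (r * K)..})
      = (\<Sum>a<r. sum g ((\<lambda>j. int a + int r * j) ` (runner r a M \<inter> {- int K..})))"
    unfolding runners_trunc[OF assms(1)]
    using assms(2) by (intro sum.UNION_disjoint) (auto dest: residue_unique)
  also have "\<dots> = (\<Sum>a<r. \<Sum>j\<in>runner r a M \<inter> {- int K..}. g (int a + int r * j))"
    using assms(1) by (intro sum.cong[of "{..<r}", OF refl]) (simp add: sum.reindex inj_on_def)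
  finally show ?thesis .
qed

text \<open>
  Cutting \<open>beads c lam\<close> off at \<open>- r * K\<close> cuts every runner off at \<open>- K\<close>. Counting beads,
  and summing their positions \<open>a + r * j\<close>, runner by runner therefore expresses charge
  and size of the whole through those of the runners. The correction terms depend on the
  charges and the cut-off alone.
\<close>
lemma runners_charge_size:
  assumes r: "r > 0" and lam: "lam \<in> partitions" "deep (r * K) c lam"
    and q: "\<And>a. a < r \<Longrightarrow> q a \<in> partitions" "\<And>a. a < r \<Longrightarrow> deep K (d a) (q a)"
      "\<And>a. a < r \<Longrightarrow> runner r a (beads c lam) = beads (d a) (q a)"
  shows "c = (\<Sum>a<r. d a)"
    and "int (psize lam) + vacuum (r * K) c
      = int r * int (\<Sum>a<r. psize (q a)) + (\<Sum>a<r. int a * (d a + int K) + int r * vacuum K (d a))"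
proof -
  let ?T = "\<lambda>a. runner r a (beads c lam) \<inter> {- int K..}"
  have T: "finite (?T a)" "int (card (?T a)) = d a + int K" "\<Sum>(?T a) = int (psize (q a)) + vacuum K (d a)"
    if "a < r" for a
    using beads_trunc[OF q(1,2)[OF that]] q(3)[OF that] by simp_all
  have S: "sum g (beads c lam \<inter> {- int (r * K)..}) = (\<Sum>a<r. \<Sum>j\<in>?T a. g (int a + int r * j))"
    for g :: "int \<Rightarrow> int"
    by (intro sum_runners r T(1))
  note L = beads_trunc[OF lam]
  have "c + int (r * K) = (\<Sum>k\<in>beads c lam \<inter> {- int (r * K)..}. 1)" using L(2) by simp
  also have "\<dots> = (\<Sum>a<r. d a + int K)" unfolding S using T(2) by (intro sum.cong) simp_all
  finally show "c = (\<Sum>a<r. d a)" by (simp add: sum.distrib)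
  have "int (psize lam) + vacuum (r * K) c = (\<Sum>k\<in>beads c lam \<inter> {- int (r * K)..}. k)"
    using L(3) by simp
  also have "\<dots> = (\<Sum>a<r. int a * (d a + int K) + int r * (int (psize (q a)) + vacuum K (d a)))"
    unfolding S
  proof (rule sum.cong[OF refl])
    fix a assume "a \<in> {..<r}"
    then have a: "a < r" by simp
    have "(\<Sum>j\<in>?T a. int a + int r * j) = int a * int (card (?T a)) + int r * \<Sum>(?T a)"
      by (simp add: sum.distrib sum_distrib_left)
    then show "(\<Sum>j\<in>?T a. int a + int r * j)
        = int a * (d a + int K) + int r * (int (psize (q a)) + vacuum K (d a))"
      by (simp only: T(2,3)[OF a])
  qed
  finally show "int (psize lam) + vacuum (r * K) c
      = int r * int (\<Sum>a<r. psize (q a)) + (\<Sum>a<r. int a * (d a + int K) + int r * vacuum K (d a))"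
    by (simp add: algebra_simps sum.distrib sum_distrib_left)
qed

lemma deep_eventually:
  assumes "lam \<in> partitions" shows "\<forall>\<^sub>F K in sequentially. deep K c lam"
proof -
  obtain K where "deep K c lam" using deep_exists[OF assms] by blast
  then show ?thesis using deep_mono[OF assms] by (auto simp: eventually_sequentially)
qed

text \<open>
  A common cut-off for a configuration and all its runners; stating it for all large \<open>K\<close>
  allows several partitions to share one.
\<close>
lemma runners_deep:
  assumes r: "r > 0" and "lam \<in> partitions" "\<And>a. a < r \<Longrightarrow> q a \<in> partitions"
  shows "\<forall>\<^sub>F K in sequentially. deep (r * K) c lam \<and> (\<forall>a<r. deep K (d a) (q a))"
proof (rule eventually_conj)
  have "filterlim (\<lambda>K. r * K) sequentially sequentially"
    using r by (rule mult_nat_left_at_top)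
  then show "\<forall>\<^sub>F K in sequentially. deep (r * K) c lam"
    using deep_eventually[OF assms(2)] by (rule eventually_compose_filterlim[rotated])
  have "\<forall>\<^sub>F K in sequentially. \<forall>a\<in>{..<r}. deep K (d a) (q a)"
    using deep_eventually assms(3) by (intro eventually_ball_finite) auto
  then show "\<forall>\<^sub>F K in sequentially. \<forall>a<r. deep K (d a) (q a)" by (rule eventually_mono) auto
qed

lemma runners_charge:
  assumes r: "r > 0" and lam: "lam \<in> partitions"
    and q: "\<And>a. a < r \<Longrightarrow> q a \<in> partitions"
      "\<And>a. a < r \<Longrightarrow> runner r a (beads c lam) = beads (d a) (q a)"
  shows "c = (\<Sum>a<r. d a)"
proof -
  have "\<forall>\<^sub>F K in sequentially. deep (r * K) c lam \<and> (\<forall>a<r. deep K (d a) (q a))"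
    by (intro runners_deep r lam q(1))
  then obtain K where "deep (r * K) c lam \<and> (\<forall>a<r. deep K (d a) (q a))"
    using eventually_happens'[OF sequentially_bot] by blast
  then show ?thesis using lam q by (intro runners_charge_size(1)[where K=K and q=q and lam=lam] r) auto
qed

text \<open>
  Among partitions whose runners have the same charges, the size differs from \<open>r\<close> times
  the total size of the \<open>r\<close>-quotient by a constant.
\<close>
lemma runners_size:
  assumes r: "r > 0" and lam: "lam \<in> partitions" "lam' \<in> partitions"
    and q: "\<And>a. a < r \<Longrightarrow> q a \<in> partitions"
      "\<And>a. a < r \<Longrightarrow> runner r a (beads c lam) = beads (d a) (q a)"
    and q': "\<And>a. a < r \<Longrightarrow> q' a \<in> partitions"
      "\<And>a. a < r \<Longrightarrow> runner r a (beads c lam') = beads (d a) (q' a)"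
  shows "int (psize lam) - int r * int (\<Sum>a<r. psize (q a))
    = int (psize lam') - int r * int (\<Sum>a<r. psize (q' a))"
proof -
  have "\<forall>\<^sub>F K in sequentially. (deep (r * K) c lam \<and> (\<forall>a<r. deep K (d a) (q a)))
      \<and> (deep (r * K) c lam' \<and> (\<forall>a<r. deep K (d a) (q' a)))"
    by (intro eventually_conj[OF runners_deep runners_deep] r lam q(1) q'(1))
  then obtain K where K: "deep (r * K) c lam \<and> (\<forall>a<r. deep K (d a) (q a))"
      "deep (r * K) c lam' \<and> (\<forall>a<r. deep K (d a) (q' a))"
    using eventually_happens'[OF sequentially_bot] by blast
  then have "int (psize lam) + vacuum (r * K) c
      = int r * int (\<Sum>a<r. psize (q a)) + (\<Sum>a<r. int a * (d a + int K) + int r * vacuum K (d a))"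
     "int (psize lam') + vacuum (r * K) c
      = int r * int (\<Sum>a<r. psize (q' a)) + (\<Sum>a<r. int a * (d a + int K) + int r * vacuum K (d a))"
    using K by (auto intro!: runners_charge_size(2) r lam q q' simp del: of_nat_sum)
  then show ?thesis by linarith
qed

text \<open>
  For \<open>a < r\<close> the runner of a partition is itself a bead configuration, by
  \<open>beads_exist\<close>, and its charge and partition are unique, by \<open>beads_unique\<close>.
\<close>
definition charge :: "nat \<Rightarrow> (nat \<Rightarrow> nat) \<Rightarrow> nat \<Rightarrow> int" where
  "charge r lam a = (THE c. \<exists>mu\<in>partitions. runner r a (beads 0 lam) = beads c mu)"

definition r_quotient :: "nat \<Rightarrow> (nat \<Rightarrow> nat) \<Rightarrow> nat \<Rightarrow> (nat \<Rightarrow> nat)" where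
  "r_quotient r lam a = (THE mu. mu \<in> partitions \<and> (\<exists>c. runner r a (beads 0 lam) = beads c mu))"

lemma charge_r_quotient_unique:
  assumes "mu \<in> partitions" "runner r a (beads 0 lam) = beads c mu"
  shows "charge r lam a = c" "r_quotient r lam a = mu"
proof -
  have "d = c \<and> nu = mu" if "nu \<in> partitions" "runner r a (beads 0 lam) = beads d nu" for d nu
    using beads_unique[of nu mu d c] that assms by simp
  then show "charge r lam a = c" "r_quotient r lam a = mu"
    unfolding charge_def r_quotient_def using assms by (auto intro!: the_equality)
qed

text \<open>
  The absolute values make the bounds insensitive to the signs of \<open>L\<close> and \<open>U\<close>; the
  further \<open>- 1\<close> absorbs the offset \<open>a < r\<close>.
\<close>
lemma runner_bounds:
  assumes "r > 0" "{..<L} \<subseteq> M" "M \<subseteq> {..U}" "a < r"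
  shows "{..< - \<bar>L\<bar> - 1} \<subseteq> runner r a M" "runner r a M \<subseteq> {..\<bar>U\<bar>}"
proof -
  show "{..< - \<bar>L\<bar> - 1} \<subseteq> runner r a M"
  proof
    fix j assume "j \<in> {..< - \<bar>L\<bar> - 1}"
    then have j: "j + 1 \<le> - \<bar>L\<bar>" by auto
    then have "int r * (j + 1) \<le> 1 * (j + 1)" using assms(1) by (intro mult_right_mono_neg) auto
    then have "int a + int r * j < L" using j assms(4) by (simp add: distrib_left)
    then show "j \<in> runner r a M" using assms(2) by (auto simp: runner_def)
  qed
  show "runner r a M \<subseteq> {..\<bar>U\<bar>}"
  proof
    fix j assume "j \<in> runner r a M"
    then have U: "int a + int r * j \<le> U" using assms(3) by (auto simp: runner_def)
    have "j \<le> \<bar>U\<bar>"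
    proof (cases "j \<ge> 0")
      case True
      then have "1 * j \<le> int r * j" using assms(1) by (intro mult_right_mono) auto
      then show ?thesis using U by simp
    qed simp
    then show "j \<in> {..\<bar>U\<bar>}" by simp
  qed
qed

lemma runner_beads:
  assumes "r > 0" "lam \<in> partitions" "a < r"
  shows "r_quotient r lam a \<in> partitions"
    "runner r a (beads 0 lam) = beads (charge r lam a) (r_quotient r lam a)"
proof -
  obtain L where "{..<L} \<subseteq> beads 0 lam" using beads_lower[OF assms(2)] by blast
  from runner_bounds[OF assms(1) this beads_upper[OF assms(2)] assms(3)]
  obtain c mu where "mu \<in> partitions" "runner r a (beads 0 lam) = beads c mu"
    by (rule beads_exist)
  then show "r_quotient r lam a \<in> partitions"
    "runner r a (beads 0 lam) = beads (charge r lam a) (r_quotient r lam a)"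
    using charge_r_quotient_unique by metis+
qed

lemma charge_sum: "r > 0 \<Longrightarrow> lam \<in> partitions \<Longrightarrow> (\<Sum>a<r. charge r lam a) = 0"
  using runners_charge[of r lam "r_quotient r lam" 0 "charge r lam"] runner_beads by simp

text \<open>
  Any choice of runners glues to a bead configuration; its charge is the sum of the
  charges of the runners, so it comes from an unshifted partition exactly when they sum
  to zero.
\<close>
lemma partition_of_runners:
  assumes r: "r > 0" and q: "\<And>a. a < r \<Longrightarrow> q a \<in> partitions" and d: "(\<Sum>a<r. d a) = 0"
  shows "\<exists>lam\<in>partitions. \<forall>a<r. charge r lam a = d a \<and> r_quotient r lam a = q a"
proof -
  define M where "M = (\<Union>a<r. (\<lambda>j. int a + int r * j) ` beads (d a) (q a))"
  have run: "runner r a M = beads (d a) (q a)" if "a < r" for a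
  proof (intro equalityI subsetI)
    fix j assume "j \<in> runner r a M"
    then obtain a' j' where aj: "a' < r" "j' \<in> beads (d a') (q a')"
      "int a + int r * j = int a' + int r * j'" by (auto simp: runner_def M_def)
    then show "j \<in> beads (d a) (q a)" using residue_unique[OF that aj(1,3)] by simp
  next
    fix j assume "j \<in> beads (d a) (q a)"
    then show "j \<in> runner r a M" using that by (auto simp: runner_def M_def)
  qed
  have "\<exists>L U. \<forall>a<r. {..<L} \<subseteq> beads (d a) (q a) \<and> beads (d a) (q a) \<subseteq> {..U}"
  proof -
    have "\<forall>a. \<exists>L. a < r \<longrightarrow> {..<L} \<subseteq> beads (d a) (q a)" using beads_lower q by blast
    then obtain L where L: "\<And>a. a < r \<Longrightarrow> {..<L a} \<subseteq> beads (d a) (q a)" by metis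
    have U: "\<And>a. a < r \<Longrightarrow> beads (d a) (q a) \<subseteq> {..bead (d a) (q a) 0}" using beads_upper q by blast
    let ?L = "Min (L ` {..<r})" and ?U = "Max ((\<lambda>a. bead (d a) (q a) 0) ` {..<r})"
    have "{..<?L} \<subseteq> beads (d a) (q a) \<and> beads (d a) (q a) \<subseteq> {..?U}" if "a < r" for a
    proof -
      have "?L \<le> L a" "bead (d a) (q a) 0 \<le> ?U" using that by auto
      then show ?thesis using L[OF that] U[OF that] by fastforce
    qed
    then show ?thesis by blast
  qed
  then obtain L U where LU: "\<And>a. a < r \<Longrightarrow> {..<L} \<subseteq> beads (d a) (q a)"
    "\<And>a. a < r \<Longrightarrow> beads (d a) (q a) \<subseteq> {..U}" by blast
  have "{..< int r * (L - 1)} \<subseteq> M"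
  proof
    fix k assume k: "k \<in> {..< int r * (L - 1)}"
    obtain a j where aj: "a < r" "k = int a + int r * j" using r by (rule residue_exists)
    have "int r * j < int r * (L - 1)" using k unfolding aj(2) lessThan_iff by linarith
    then have "j < L" using r by simp
    then show "k \<in> M" using LU(1)[OF aj(1)] aj by (auto simp: M_def)
  qed
  moreover have "M \<subseteq> {..int r * (U + 1)}"
  proof
    fix k assume "k \<in> M"
    then obtain a j where aj: "a < r" "k = int a + int r * j" "j \<le> U"
      using LU(2) by (fastforce simp: M_def)
    then have "int r * j \<le> int r * U" by (intro mult_left_mono) auto
    then show "k \<in> {..int r * (U + 1)}"
      using aj(1) unfolding aj(2) distrib_left atMost_iff by linarith
  qed
  ultimately obtain c lam where lam: "lam \<in> partitions" "M = beads c lam" by (rule beads_exist)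
  then have "c = 0" using runners_charge[of r lam q c d] r q run d by simp
  then have "runner r a (beads 0 lam) = beads (d a) (q a)" if "a < r" for a
    using run[OF that] lam by simp
  then have "charge r lam a = d a \<and> r_quotient r lam a = q a" if "a < r" for a
    using charge_r_quotient_unique[OF q[OF that]] that by blast
  then show ?thesis using lam(1) by blast
qed

section \<open>Exchanges and the r-core\<close>

lemma seq01_beads: "seq01 lam k = (if k \<in> beads 0 lam then 0 else 1)"
  by (auto simp: seq01_def beads_def bead_def image_iff)

lemma seq01_inj:
  assumes "lam \<in> partitions" "mu \<in> partitions" "seq01 lam = seq01 mu"
  shows "lam = mu"
proof -
  have "k \<in> beads 0 lam \<longleftrightarrow> k \<in> beads 0 mu" for k
    using fun_cong[OF assms(3), of k] by (simp add: seq01_beads split: if_splits)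
  then show ?thesis using beads_unique(2)[OF assms(1,2)] by blast
qed

text \<open>
  The number of exchanges that lead from \<open>lam\<close> to its \<open>r\<close>-core.
\<close>
definition weight :: "nat \<Rightarrow> (nat \<Rightarrow> nat) \<Rightarrow> nat" where
  "weight r lam = (\<Sum>a<r. psize (r_quotient r lam a))"

text \<open>
  An exchange moves one bead of a single runner by one step. Hence it leads to a
  partition again, preserves all charges, and lowers the weight by one.
\<close>
lemma exchange_partition:
  assumes r: "r > 0" and lam: "lam \<in> partitions" and ex: "exchange r (seq01 lam) s"
  obtains mu where "mu \<in> partitions" "s = seq01 mu"
    "\<And>a. a < r \<Longrightarrow> charge r mu a = charge r lam a" "weight r lam = Suc (weight r mu)"
proof -
  let ?B = "beads 0 lam"
  obtain k where k01: "seq01 lam k = 1" "seq01 lam (k + int r) = 0"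
    and s: "s = (seq01 lam)(k := 0, k + int r := 1)"
    using ex by (blast elim: exchange.cases)
  have k: "k \<notin> ?B" "k + int r \<in> ?B"
    using k01 by (simp_all add: seq01_beads split: if_splits)
  \<comment> \<open>The bead moves on runner \<open>a0\<close>, from position \<open>j0 + 1\<close> to \<open>j0\<close>.\<close>
  obtain a0 j0 where aj: "a0 < r" "k = int a0 + int r * j0" using r by (rule residue_exists)
  define M where "M = insert k (?B - {k + int r})"
  have run: "runner r a M = (if a = a0 then insert j0 (runner r a ?B - {j0 + 1}) else runner r a ?B)"
    if "a < r" for a
    using residue_unique[OF that aj(1), of _ j0] residue_unique[OF that aj(1), of _ "j0 + 1"] r
    by (auto simp: runner_def M_def aj(2) algebra_simps)
  have b: "j0 \<notin> beads (charge r lam a0) (r_quotient r lam a0)"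
    "j0 + 1 \<in> beads (charge r lam a0) (r_quotient r lam a0)"
    using k runner_beads(2)[OF r lam aj(1)]
    by (auto simp flip: runner_beads(2)[OF r lam aj(1)] simp: runner_def aj(2) algebra_simps)
  obtain nu where nu: "nu \<in> partitions"
    "insert j0 (beads (charge r lam a0) (r_quotient r lam a0) - {j0 + 1}) = beads (charge r lam a0) nu"
    "psize (r_quotient r lam a0) = Suc (psize nu)"
    using runner_beads(1)[OF r lam aj(1)] b by (rule beads_move)
  define q where "q = (r_quotient r lam)(a0 := nu)"
  have q: "q a \<in> partitions" "runner r a M = beads (charge r lam a) (q a)" if "a < r" for a
    using runner_beads[OF r lam that] nu run[OF that] by (auto simp: q_def)
  obtain L where "{..<L} \<subseteq> ?B" using beads_lower[OF lam] by blast
  then have "{..<min L (k + int r)} \<subseteq> M" by (auto simp: M_def)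
  moreover have "M \<subseteq> {..max k (bead 0 lam 0)}" using beads_upper[OF lam, of 0] by (auto simp: M_def)
  ultimately obtain c mu where mu: "mu \<in> partitions" "M = beads c mu" by (rule beads_exist)
  have "c = (\<Sum>a<r. charge r lam a)"
    using runners_charge[of r mu q c "charge r lam"] r mu q by simp
  then have M: "M = beads 0 mu" using charge_sum[OF r lam] mu by simp
  have cq: "charge r mu a = charge r lam a" "r_quotient r mu a = q a" if "a < r" for a
    using charge_r_quotient_unique q[OF that] unfolding M by blast+
  have "s x = seq01 mu x" for x
    using r by (auto simp: s seq01_beads M[symmetric] M_def)
  moreover have "weight r lam = Suc (weight r mu)"
    using cq(2) nu(3) aj(1) by (simp add: weight_def q_def sum.remove[of "{..<r}" a0])
  ultimately show thesis using that mu(1) cq(1) by blast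
qed

lemma exchanges_partition:
  assumes r: "r > 0" and lam: "lam \<in> partitions" and ex: "(exchange r)\<^sup>*\<^sup>* (seq01 lam) s"
  shows "\<exists>mu\<in>partitions. s = seq01 mu \<and> (\<forall>a<r. charge r mu a = charge r lam a)"
  using ex
proof induction
  case base then show ?case using lam by blast
next
  case (step s t)
  then show ?case using exchange_partition[OF r] by metis
qed

lemma terminal_exists:
  assumes r: "r > 0" and "lam \<in> partitions"
  shows "\<exists>mu\<in>partitions. (exchange r)\<^sup>*\<^sup>* (seq01 lam) (seq01 mu) \<and> (\<nexists>s. exchange r (seq01 mu) s)"
  using assms(2)
proof (induction "weight r lam" arbitrary: lam rule: less_induct)
  case less
  show ?case
  proof (cases "\<exists>s. exchange r (seq01 lam) s")
    case True
    then obtain s where s: "exchange r (seq01 lam) s" by blast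
    then obtain mu where mu: "mu \<in> partitions" "s = seq01 mu" "weight r lam = Suc (weight r mu)"
      by (rule exchange_partition[OF r less.prems])
    then show ?thesis using less.hyps[of mu] s by (metis converse_rtranclp_into_rtranclp lessI)
  next
    case False
    then show ?thesis using less.prems by blast
  qed
qed

text \<open>
  If no exchange is possible, every runner is closed under going left, so it is a
  half-line.
\<close>
lemma terminal_quotient:
  assumes r: "r > 0" and lam: "lam \<in> partitions" and t: "\<nexists>s. exchange r (seq01 lam) s" and a: "a < r"
  shows "r_quotient r lam a = (\<lambda>_. 0)"
proof (rule beads_downclosed[OF runner_beads(1)[OF r lam a]])
  fix j assume "j + 1 \<in> beads (charge r lam a) (r_quotient r lam a)"
  then have j: "(int a + int r * j) + int r \<in> beads 0 lam"
    unfolding runner_beads(2)[OF r lam a, symmetric] by (simp add: runner_def algebra_simps)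
  have "int a + int r * j \<in> beads 0 lam"
  proof (rule ccontr)
    assume "int a + int r * j \<notin> beads 0 lam"
    then have "exchange r (seq01 lam) ((seq01 lam)(int a + int r * j := 0, int a + int r * j + int r := 1))"
      using j by (intro exchange.intros) (auto simp: seq01_beads)
    then show False using t by blast
  qed
  then show "j \<in> beads (charge r lam a) (r_quotient r lam a)"
    unfolding runner_beads(2)[OF r lam a, symmetric] by (simp add: runner_def)
qed

lemma charge_quotient_determine:
  assumes r: "r > 0" and "lam \<in> partitions" "mu \<in> partitions"
    and "\<And>a. a < r \<Longrightarrow> charge r lam a = charge r mu a" "\<And>a. a < r \<Longrightarrow> r_quotient r lam a = r_quotient r mu a"
  shows "lam = mu"
proof -
  have "runner r a (beads 0 lam) = runner r a (beads 0 mu)" if "a < r" for a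
    unfolding runner_beads(2)[OF r assms(2) that] runner_beads(2)[OF r assms(3) that]
      assms(4)[OF that] assms(5)[OF that] ..
  then have "beads 0 lam = beads 0 mu" by (rule runner_ext[OF r])
  then show ?thesis using beads_unique(2) assms by blast
qed

lemma terminal_unique:
  assumes r: "r > 0" and lam: "lam \<in> partitions" "\<nexists>s. exchange r (seq01 lam) s"
    and mu: "mu \<in> partitions" "\<nexists>s. exchange r (seq01 mu) s"
    and c: "\<And>a. a < r \<Longrightarrow> charge r lam a = charge r mu a"
  shows "lam = mu"
  using terminal_quotient[OF r lam] terminal_quotient[OF r mu]
  by (intro charge_quotient_determine[OF r lam(1) mu(1) c]) auto

text \<open>
  The \<open>r\<close>-core is determined by the charges of the runners: exchanges preserve them, the
  weight forces termination, and a terminal sequence consists of half-lines, which are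
  fixed by their charges.
\<close>
lemma r_core_iff:
  assumes r: "r > 0" and lam: "lam \<in> partitions"
    and om: "om \<in> partitions" "\<nexists>s. exchange r (seq01 om) s"
  shows "r_core r lam = om \<longleftrightarrow> (\<forall>a<r. charge r lam a = charge r om a)"
proof -
  obtain mu where mu: "mu \<in> partitions" "(exchange r)\<^sup>*\<^sup>* (seq01 lam) (seq01 mu)" "\<nexists>s. exchange r (seq01 mu) s"
    using terminal_exists[OF r lam] by blast
  have charges: "charge r nu a = charge r lam a"
    if "nu \<in> partitions" "(exchange r)\<^sup>*\<^sup>* (seq01 lam) (seq01 nu)" "a < r" for nu a
    using exchanges_partition[OF r lam that(2)] seq01_inj that(1,3) by metis
  have "r_core r lam = mu"
    unfolding r_core_def
  proof (rule the_equality)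
    fix nu assume nu: "nu \<in> partitions \<and> (exchange r)\<^sup>*\<^sup>* (seq01 lam) (seq01 nu) \<and> (\<nexists>s. exchange r (seq01 nu) s)"
    then show "nu = mu" using charges mu by (intro terminal_unique[OF r]) auto
  qed (use mu in blast)
  moreover have "mu = om \<longleftrightarrow> (\<forall>a<r. charge r lam a = charge r om a)"
    using charges[OF mu(1,2)] terminal_unique[OF r mu(1,3) om] by auto
  ultimately show ?thesis by simp
qed

text \<open>
  The classical correspondence between hooks and pairs consisting of a bead and a gap to
  its left. The row of the hook is that of the bead; its column \<open>j\<close> comes from the
  number \<open>m\<close> of beads to the right of the gap \<open>k\<close>, as \<open>j = k + m\<close>.
\<close>
lemma hook_of_bead_gap:
  assumes lam: "lam \<in> partitions" and k: "k \<notin> beads 0 lam" "k + int r \<in> beads 0 lam" and r: "r > 0"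
  obtains s where "s \<in> diagram lam" "hook lam s = r"
proof -
  obtain i where i: "k + int r = bead 0 lam i" using k(2) by (auto simp: beads_def)
  obtain N where N: "lam N = 0" using lam by (rule partition_eventually_0)
  have "\<exists>m. bead 0 lam m < k"
  proof -
    have "bead 0 lam (max N (nat (1 - k))) < k"
      using partition_zero_mono[OF lam N, of "max N (nat (1 - k))"] by (simp add: bead_def)
    then show ?thesis by blast
  qed
  \<comment> \<open>\<open>m\<close> is the first row whose bead lies left of the gap; the hook found below starts in row \<open>i\<close> and ends in row \<open>m - 1\<close>.\<close>
  define m where "m = (LEAST m. bead 0 lam m < k)"
  have m: "bead 0 lam m < k" unfolding m_def using \<open>\<exists>m. bead 0 lam m < k\<close> by (rule LeastI_ex)
  have above: "k < bead 0 lam i'" if "i' < m" for i'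
    using not_less_Least[of i' "\<lambda>m. bead 0 lam m < k"] that k(1)
    by (metis beads_def linorder_neqE_linordered_idom m_def rangeI)
  have im: "i < m"
  proof (rule ccontr)
    assume "\<not> i < m"
    then have "bead 0 lam i \<le> bead 0 lam m" using bead_less[OF lam, of m i 0] by (cases "i = m") auto
    then show False using i m r by simp
  qed
  define j where "j = nat (k + int m)"
  have j: "int j = k + int m" using m by (simp add: j_def bead_def)
  have "j < lam i' \<longleftrightarrow> i' < m" for i'
  proof
    assume "i' < m"
    then have "lam (m - 1) \<le> lam i'" by (intro partition_antimono[OF lam]) auto
    moreover have "k < bead 0 lam (m - 1)" using above \<open>i' < m\<close> by simp
    ultimately show "j < lam i'" using j \<open>i' < m\<close> by (simp add: bead_def)
  next
    assume "j < lam i'"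
    moreover have "lam m \<le> j" using m j by (simp add: bead_def)
    ultimately show "i' < m" using partition_antimono[OF lam, of m i'] by (metis not_less order_trans)
  qed
  then have conj: "conjugate lam j = m" and ij: "j < lam i" using im by (simp_all add: conjugate_def)
  have "hook lam (i, j) = r"
    using i ij im j unfolding hook_def arm_def leg_def conj by (simp add: conj bead_def)
  then show thesis using that[of "(i, j)"] ij by (simp add: diagram_def)
qed

text \<open>
  A possible exchange would exhibit a hook of length exactly \<open>r\<close>.
\<close>
lemma r_core_terminal:
  assumes "r > 0" "is_r_core r om"
  shows "\<nexists>s. exchange r (seq01 om) s"
proof
  assume "\<exists>s. exchange r (seq01 om) s"
  then obtain k where "k \<notin> beads 0 om" "k + int r \<in> beads 0 om"
    by (auto elim!: exchange.cases simp: seq01_beads split: if_splits)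
  then obtain s where "s \<in> diagram om" "hook om s = r"
    using hook_of_bead_gap assms by (metis is_r_core_def)
  then show False using assms(2) by (auto simp: is_r_core_def)
qed

section \<open>Bottom hooks\<close>

text \<open>
  The leg of the square \<open>(i, j)\<close> vanishes if and only if the next row does not reach its
  column. The inequality matches the truncated subtraction in \<open>leg\<close>.
\<close>
lemma conjugate_le_Suc_iff:
  assumes "lam \<in> partitions" "j < lam i"
  shows "conjugate lam j \<le> Suc i \<longleftrightarrow> lam (Suc i) \<le> j"
proof -
  obtain N where N: "lam N = 0" using assms(1) by (rule partition_eventually_0)
  have "k < N" if "j < lam k" for k
    using that partition_zero_mono[OF assms(1) N, of k] by (cases "k < N") auto
  then have "{k. j < lam k} \<subseteq> {..<N}" by blast
  then have fin: "finite {k. j < lam k}" by (rule finite_subset) simp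
  show ?thesis
  proof
    assume "lam (Suc i) \<le> j"
    then have "k < Suc i" if "j < lam k" for k
      using that partition_antimono[OF assms(1), of "Suc i" k] by (cases "k < Suc i") auto
    then have "{i. j < lam i} \<subseteq> {..<Suc i}" by blast
    then show "conjugate lam j \<le> Suc i" unfolding conjugate_def
      using card_mono[of "{..<Suc i}" "{i. j < lam i}"] by simp
  next
    assume le: "conjugate lam j \<le> Suc i"
    show "lam (Suc i) \<le> j"
    proof (rule ccontr)
      assume "\<not> lam (Suc i) \<le> j"
      then have "j < lam k" if "k \<le> Suc i" for k
        using partition_antimono[OF assms(1) that] by simp
      then have "{..Suc i} \<subseteq> {i. j < lam i}" by auto
      then have "card {..Suc i} \<le> conjugate lam j" unfolding conjugate_def by (rule card_mono[OF fin])
      then show False using le by simp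
    qed
  qed
qed

lemma bottom_squares_eq:
  assumes "lam \<in> partitions" "lam N = 0"
  shows "bottom_squares lam = (SIGMA i:{..<N}. {lam (Suc i)..<lam i})"
proof -
  have "i < N" if "j < lam i" for i j
    using that partition_zero_mono[OF assms, of i] by (metis not_less not_less_zero)
  then show ?thesis
    using conjugate_le_Suc_iff[OF assms(1)]
    by (auto simp: bottom_squares_def diagram_def leg_def)
qed

text \<open>
  The bottom squares in row \<open>i\<close> are the last \<open>lam i - lam (Suc i)\<close> ones, with
  hook-lengths \<open>1, 2, \<dots>, lam i - lam (Suc i)\<close>. So the product depends only on the
  integer quotients of the gaps between consecutive parts by \<open>r\<close>.
\<close>
lemma prod_bottom_hooks:
  fixes f :: "nat \<Rightarrow> 'a::comm_monoid_mult"
  assumes "lam \<in> partitions" "lam N = 0" "r > 0"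
  shows "(\<Prod>h\<in>#bottom_hooks r lam. f h)
    = (\<Prod>i<N. \<Prod>k=1..(lam i - lam (Suc i)) div r. f (r * k))"
proof -
  note B = bottom_squares_eq[OF assms(1,2)]
  have hook: "hook lam (i, j) = lam i - j" if "(i, j) \<in> bottom_squares lam" for i j
    using that by (auto simp: bottom_squares_def diagram_def hook_def arm_def)
  have "(\<Prod>h\<in>#bottom_hooks r lam. f h)
      = (\<Prod>s\<in>{s \<in> bottom_squares lam. r dvd hook lam s}. f (hook lam s))"
    unfolding bottom_hooks_def filter_mset_image_mset prod_unfold_prod_mset
    by (simp add: B filter_mset_mset_set multiset.map_comp o_def)
  also have "{s \<in> bottom_squares lam. r dvd hook lam s}
      = (SIGMA i:{..<N}. {j \<in> {lam (Suc i)..<lam i}. r dvd lam i - j})"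
    using hook unfolding B by auto
  also have "(\<Prod>s\<in>\<dots>. f (hook lam s))
      = (\<Prod>(i, j)\<in>(SIGMA i:{..<N}. {j \<in> {lam (Suc i)..<lam i}. r dvd lam i - j}). f (lam i - j))"
    using hook unfolding B by (intro prod.cong) auto
  also have "\<dots> = (\<Prod>i<N. \<Prod>j\<in>{j \<in> {lam (Suc i)..<lam i}. r dvd lam i - j}. f (lam i - j))"
    by (rule prod.Sigma[symmetric]) auto
  also have "\<dots> = (\<Prod>i<N. \<Prod>k=1..(lam i - lam (Suc i)) div r. f (r * k))"
  proof (rule prod.cong[OF refl])
    fix i
    have k: "r * k \<le> lam i - lam (Suc i)" if "k \<le> (lam i - lam (Suc i)) div r" for k
      using that assms(3) by (simp add: less_eq_div_iff_mult_less_eq mult.commute)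
    show "(\<Prod>j\<in>{j \<in> {lam (Suc i)..<lam i}. r dvd lam i - j}. f (lam i - j))
        = (\<Prod>k=1..(lam i - lam (Suc i)) div r. f (r * k))"
    proof (rule prod.reindex_bij_witness[of _ "\<lambda>k. lam i - r * k" "\<lambda>j. (lam i - j) div r"])
      fix j assume j: "j \<in> {j \<in> {lam (Suc i)..<lam i}. r dvd lam i - j}"
      then obtain k where k: "lam i - j = r * k" by (auto elim: dvdE)
      then have "k > 0" using j by (cases k) auto
      moreover have "r * k \<le> lam i - lam (Suc i)" using k j by auto
      ultimately show "(lam i - j) div r \<in> {1..(lam i - lam (Suc i)) div r}"
        using k assms(3) by (simp add: less_eq_div_iff_mult_less_eq mult.commute)
      show "lam i - r * ((lam i - j) div r) = j" using j by simp
      show "f (r * ((lam i - j) div r)) = f (lam i - j)" using j by simp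
    next
      fix n assume n: "n \<in> {1..(lam i - lam (Suc i)) div r}"
      then have le: "r * n \<le> lam i - lam (Suc i)" using k by simp
      have pos: "0 < r * n" using n assms(3) by simp
      show "(lam i - (lam i - r * n)) div r = n" using le assms(3) by simp
      have in_gap: "lam i - m \<in> {j \<in> {lam (Suc i)..<lam i}. r dvd lam i - j}"
        if "0 < m" "m \<le> lam i - lam (Suc i)" "r dvd m" for m
        using that by auto
      show "lam i - r * n \<in> {j \<in> {lam (Suc i)..<lam i}. r dvd lam i - j}"
        by (rule in_gap[OF pos le dvd_triv_left])
    qed
  qed
  finally show ?thesis .
qed

section \<open>Division of gaps with remainder\<close>

definition scale_add :: "nat \<Rightarrow> (nat \<Rightarrow> nat) \<Rightarrow> (nat \<Rightarrow> nat) \<Rightarrow> nat \<Rightarrow> nat" where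
  "scale_add r mu nu i = r * mu i + nu i"

lemma partitions_common_zero:
  assumes "mu \<in> partitions" "nu \<in> partitions"
  obtains N where "mu N = 0" "nu N = 0"
proof -
  obtain N N' where N: "mu N = 0" "nu N' = 0" using assms by (metis partition_eventually_0)
  show thesis using partition_zero_mono[OF assms(1) N(1), of "max N N'"]
    partition_zero_mono[OF assms(2) N(2), of "max N N'"] that by simp
qed

lemma scale_add_partition:
  assumes "mu \<in> partitions" "nu \<in> partitions"
  shows "scale_add r mu nu \<in> partitions" "psize (scale_add r mu nu) = r * psize mu + psize nu"
proof -
  obtain N where N: "mu N = 0" "nu N = 0" using assms by (rule partitions_common_zero)
  have zero: "scale_add r mu nu N = 0" using N by (simp add: scale_add_def)
  show *: "scale_add r mu nu \<in> partitions"
    by (rule partitionI[where N=N])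
      (use zero partition_antimono[OF assms(1)] partition_antimono[OF assms(2)]
        in \<open>auto simp: scale_add_def intro!: add_mono mult_left_mono\<close>)
  show "psize (scale_add r mu nu) = r * psize mu + psize nu"
    unfolding psize_eq[OF * zero] psize_eq[OF assms(1) N(1)] psize_eq[OF assms(2) N(2)]
    by (simp add: scale_add_def sum.distrib sum_distrib_left)
qed

text \<open>
  Up to the constant \<open>K\<close>, the charge of a runner counts how many of the bead positions
  \<open>lam i - i - 1\<close> of the rows \<open>i < r * K\<close> lie in the residue class of \<open>a\<close>.
\<close>
lemma charge_count:
  assumes r: "r > 0" and lam: "lam \<in> partitions" and a: "a < r"
    and K: "deep (r * K) 0 lam" "deep K (charge r lam a) (r_quotient r lam a)"
  shows "charge r lam a + int K = int (card {i. i < r * K \<and> bead 0 lam i mod int r = int a})"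
proof -
  let ?T = "runner r a (beads 0 lam) \<inter> {- int K..}"
  let ?I = "{i. i < r * K \<and> bead 0 lam i mod int r = int a}"
  have zero: "lam (r * K) = 0" using K(1) by (simp add: deep_def nat_mult_distrib flip: of_nat_mult)
  have T: "beads 0 lam \<inter> {- int (r * K)..} = bead 0 lam ` {..<r * K}"
    unfolding beads_split[OF lam zero] by (auto simp: bead_def simp del: of_nat_mult)
  have "(\<lambda>j. int a + int r * j) ` ?T = {k \<in> beads 0 lam \<inter> {- int (r * K)..}. k mod int r = int a}"
    unfolding runners_trunc[OF r] using a by auto
  also have "\<dots> = bead 0 lam ` ?I" unfolding T by auto
  finally have "card ((\<lambda>j. int a + int r * j) ` ?T) = card (bead 0 lam ` ?I)" by simp
  moreover have "inj_on (bead 0 lam) ?I" using bead_inj[OF lam] by (rule inj_on_subset) simp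
  ultimately have "card ?T = card ?I" using r by (simp add: card_image inj_on_def)
  then show ?thesis
    using beads_trunc(2)[OF runner_beads(1)[OF r lam a] K(2)] runner_beads(2)[OF r lam a] by simp
qed

text \<open>
  Adding a multiple of \<open>r\<close> to every part changes no residue of a bead position, hence no
  charge.
\<close>
lemma charge_scale_add:
  assumes r: "r > 0" and mu: "mu \<in> partitions" and nu: "nu \<in> partitions" and a: "a < r"
  shows "charge r (scale_add r mu nu) a = charge r nu a"
proof -
  let ?l = "scale_add r mu nu"
  note l = scale_add_partition(1)[OF mu nu, of r]
  have "\<forall>\<^sub>F K in sequentially.
      (deep (r * K) 0 ?l \<and> (\<forall>a<r. deep K (charge r ?l a) (r_quotient r ?l a))) \<and>
      (deep (r * K) 0 nu \<and> (\<forall>a<r. deep K (charge r nu a) (r_quotient r nu a)))"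
    by (intro eventually_conj[OF runners_deep runners_deep] r l nu runner_beads(1))
  then obtain K where K: "deep (r * K) 0 ?l" "\<forall>a<r. deep K (charge r ?l a) (r_quotient r ?l a)"
      "deep (r * K) 0 nu" "\<forall>a<r. deep K (charge r nu a) (r_quotient r nu a)"
    using eventually_happens'[OF sequentially_bot] by blast
  have "bead 0 ?l i = bead 0 nu i + int r * int (mu i)" for i
    by (simp add: bead_def scale_add_def)
  then have "bead 0 ?l i mod int r = bead 0 nu i mod int r" for i by simp
  then show ?thesis
    using charge_count[OF r l a K(1)] charge_count[OF r nu a K(3)] K(2,4) a by simp
qed

text \<open>
  For an \<open>r\<close>-core \<open>om\<close>, the set of partitions with \<open>r\<close>-core \<open>om\<close>, by \<open>r_core_iff\<close>.
\<close>
definition charge_class :: "nat \<Rightarrow> (nat \<Rightarrow> nat) \<Rightarrow> (nat \<Rightarrow> nat) set" where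
  "charge_class r om = {lam \<in> partitions. \<forall>a<r. charge r lam a = charge r om a}"

definition small_gaps :: "nat \<Rightarrow> (nat \<Rightarrow> nat) \<Rightarrow> (nat \<Rightarrow> nat) set" where
  "small_gaps r om = {nu \<in> charge_class r om. \<forall>i. nu i - nu (Suc i) < r}"

text \<open>
  Since partitions end in zeros, they are recovered from their gaps by descending
  summation.
\<close>
lemma gaps_determine:
  assumes "lam \<in> partitions" "mu \<in> partitions" "\<And>i. lam i - lam (Suc i) = mu i - mu (Suc i)"
  shows "lam = mu"
proof -
  obtain N where N: "lam N = 0" "mu N = 0" using assms(1,2) by (rule partitions_common_zero)
  have "lam i = mu i" for i
  proof (cases "i \<le> N")
    case True
    then show ?thesis
    proof (induction i rule: inc_induct)
      case (step i)
      have "lam i = lam i - lam (Suc i) + lam (Suc i)" "mu i = mu i - mu (Suc i) + mu (Suc i)"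
        using partition_antimono assms(1,2) by simp_all
      then show ?case using step.IH assms(3)[of i] by presburger
    qed (simp add: N)
  next
    case False
    then show ?thesis
      using partition_zero_mono[OF assms(1) N(1), of i] partition_zero_mono[OF assms(2) N(2), of i] by simp
  qed
  then show ?thesis by auto
qed

lemma scale_add_gap:
  assumes "mu \<in> partitions" "nu \<in> partitions"
  shows "scale_add r mu nu i - scale_add r mu nu (Suc i)
    = r * (mu i - mu (Suc i)) + (nu i - nu (Suc i))"
proof -
  obtain x y where "mu i = mu (Suc i) + x" "nu i = nu (Suc i) + y"
    using partition_antimono[OF assms(1), of i "Suc i"] partition_antimono[OF assms(2), of i "Suc i"]
    by (auto simp: le_iff_add)
  then show ?thesis by (simp add: scale_add_def distrib_left)
qed

text \<open>
  Division with remainder, applied to every gap between consecutive parts: the quotients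
  are the gaps of \<open>mu\<close> and the remainders those of \<open>nu\<close>. Adding \<open>r * mu\<close> preserves the
  charges, so the core conditions on \<open>nu\<close> and on the sum agree.
\<close>
lemma scale_add_bij:
  assumes r: "r > 0"
  shows "bij_betw (\<lambda>(mu, nu). scale_add r mu nu) (partitions \<times> small_gaps r om) (charge_class r om)"
  unfolding bij_betw_def
proof
  show "inj_on (\<lambda>(mu, nu). scale_add r mu nu) (partitions \<times> small_gaps r om)"
  proof (rule inj_onI, clarify)
    fix mu nu mu' nu'
    assume mu: "mu \<in> partitions" "mu' \<in> partitions" and nu: "nu \<in> small_gaps r om" "nu' \<in> small_gaps r om"
      and eq: "scale_add r mu nu = scale_add r mu' nu'"
    have nuP: "nu \<in> partitions" "nu' \<in> partitions" and gap: "\<And>i. nu i - nu (Suc i) < r" "\<And>i. nu' i - nu' (Suc i) < r"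
      using nu by (auto simp: small_gaps_def charge_class_def)
    have g: "r * (mu i - mu (Suc i)) + (nu i - nu (Suc i)) = r * (mu' i - mu' (Suc i)) + (nu' i - nu' (Suc i))" for i
      using scale_add_gap[OF mu(1) nuP(1), of r i] scale_add_gap[OF mu(2) nuP(2), of r i] eq by simp
    have "mu i - mu (Suc i) = mu' i - mu' (Suc i)" for i
      using arg_cong[OF g[of i], of "\<lambda>x. x div r"] gap[of i] r by simp
    moreover have "nu i - nu (Suc i) = nu' i - nu' (Suc i)" for i
      using arg_cong[OF g[of i], of "\<lambda>x. x mod r"] gap[of i] r by simp
    ultimately show "mu = mu' \<and> nu = nu'" using gaps_determine mu nuP by blast
  qed
next
  show "(\<lambda>(mu, nu). scale_add r mu nu) ` (partitions \<times> small_gaps r om) = charge_class r om"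
  proof (intro equalityI subsetI)
    fix lam assume "lam \<in> (\<lambda>(mu, nu). scale_add r mu nu) ` (partitions \<times> small_gaps r om)"
    then show "lam \<in> charge_class r om"
      using scale_add_partition(1) charge_scale_add[OF r]
      by (auto simp: small_gaps_def charge_class_def)
  next
    fix lam assume lam: "lam \<in> charge_class r om"
    then have lamP: "lam \<in> partitions" by (simp add: charge_class_def)
    obtain N where N: "lam N = 0" using lamP by (rule partition_eventually_0)
    define g where "g i = lam i - lam (Suc i)" for i
    have g: "lam i = lam (Suc i) + g i" for i
      using partition_antimono[OF lamP, of i "Suc i"] by (simp add: g_def)
    have g0: "g i = 0" if "N \<le> i" for i using partition_zero_mono[OF lamP N that] by (simp add: g_def)
    \<comment> \<open>The partition whose gaps are the quotients \<open>g k div r\<close>.\<close>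
    define mu where "mu i = (\<Sum>k\<in>{i..<N}. g k div r)" for i
    have mu: "mu i = mu (Suc i) + g i div r" for i
      using g0[of i] by (cases "i < N") (simp_all add: mu_def sum.atLeast_Suc_lessThan)
    have le: "r * mu i \<le> lam i \<and> r * mu (Suc i) \<le> lam (Suc i)" for i
    proof (cases "i \<le> N")
      case True
      then show ?thesis
      proof (induction i rule: inc_induct)
        case base then show ?case by (simp add: mu_def)
      next
        case (step i)
        have "r * mu i \<le> lam i"
          unfolding mu[of i] g[of i] distrib_left using step.IH by (intro add_mono) simp_all
        then show ?case using step.IH by simp
      qed
    qed (simp add: mu_def)
    define nu where "nu i = lam i - r * mu i" for i
    have nu: "nu i = nu (Suc i) + g i mod r" for i
    proof -
      have "g i = r * (g i div r) + g i mod r" by simp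
      then show ?thesis
        unfolding nu_def mu[of i] g[of i] distrib_left using le[of i] by linarith
    qed
    have muP: "mu \<in> partitions"
    proof (rule partitionI)
      show "mu (Suc i) \<le> mu i" for i using mu[of i] by simp
      show "mu N = 0" by (simp add: mu_def)
    qed
    have nuP: "nu \<in> partitions"
    proof (rule partitionI)
      show "nu (Suc i) \<le> nu i" for i using nu[of i] by simp
      show "nu N = 0" by (simp add: nu_def N)
    qed
    have eq: "lam = scale_add r mu nu" using le by (auto simp: scale_add_def nu_def)
    have "charge r lam a = charge r nu a" if "a < r" for a
      unfolding eq by (rule charge_scale_add[OF r muP nuP that])
    moreover have "nu i - nu (Suc i) < r" for i using nu[of i] r by simp
    ultimately have "nu \<in> small_gaps r om"
      using lam nuP by (simp add: small_gaps_def charge_class_def)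
    then show "lam \<in> (\<lambda>(mu, nu). scale_add r mu nu) ` (partitions \<times> small_gaps r om)"
      using eq muP by force
  qed
qed

text \<open>
  All partitions in the class have the same constant in \<open>runners_size\<close>, and it can be
  read off at the core, whose \<open>r\<close>-quotient is empty.
\<close>
lemma psize_weight:
  assumes r: "r > 0" and om: "om \<in> partitions" "\<nexists>s. exchange r (seq01 om) s"
    and lam: "lam \<in> charge_class r om"
  shows "psize lam = psize om + r * weight r lam"
proof -
  have lamP: "lam \<in> partitions" and c: "\<And>a. a < r \<Longrightarrow> charge r lam a = charge r om a"
    using lam by (auto simp: charge_class_def)
  have "int (psize lam) - int r * int (\<Sum>a<r. psize (r_quotient r lam a))
      = int (psize om) - int r * int (\<Sum>a<r. psize (r_quotient r om a))"
    by (rule runners_size[where c=0 and d="charge r om"])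
      (use runner_beads[OF r lamP] runner_beads[OF r om(1)] c r lamP om in auto)
  moreover have "(\<Sum>a<r. psize (r_quotient r om a)) = 0"
    using terminal_quotient[OF r om] zero_partition(2) by simp
  ultimately have "int (psize lam) = int (psize om + r * weight r lam)" by (simp add: weight_def)
  then show ?thesis by (simp only: of_nat_eq_iff)
qed

text \<open>
  Charges and \<open>r\<close>-quotient determine every runner, which gives injectivity. For
  surjectivity, the charges of \<open>om\<close> sum to zero and so may be combined with any tuple of
  partitions.
\<close>
lemma quotient_bij:
  assumes r: "r > 0" and om: "om \<in> partitions"
  shows "bij_betw (\<lambda>lam. restrict (r_quotient r lam) {..<r}) (charge_class r om) (PiE {..<r} (\<lambda>_. partitions))"
  unfolding bij_betw_def
proof
  show "inj_on (\<lambda>lam. restrict (r_quotient r lam) {..<r}) (charge_class r om)"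
  proof (rule inj_onI)
    fix lam mu assume A: "lam \<in> charge_class r om" "mu \<in> charge_class r om"
      "restrict (r_quotient r lam) {..<r} = restrict (r_quotient r mu) {..<r}"
    show "lam = mu"
    proof (rule charge_quotient_determine[OF r])
      show "r_quotient r lam a = r_quotient r mu a" if "a < r" for a
        using fun_cong[OF A(3), of a] that by simp
    qed (use A(1,2) in \<open>simp_all add: charge_class_def\<close>)
  qed
  show "(\<lambda>lam. restrict (r_quotient r lam) {..<r}) ` charge_class r om = PiE {..<r} (\<lambda>_. partitions)"
  proof (intro equalityI subsetI)
    fix q assume "q \<in> (\<lambda>lam. restrict (r_quotient r lam) {..<r}) ` charge_class r om"
    then show "q \<in> PiE {..<r} (\<lambda>_. partitions)"
      using runner_beads(1)[OF r] by (auto simp: charge_class_def)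
  next
    fix q assume q: "q \<in> PiE {..<r} (\<lambda>_. partitions)"
    have qP: "q a \<in> partitions" if "a < r" for a using q that by auto
    have "\<exists>lam\<in>partitions. \<forall>a<r. charge r lam a = charge r om a \<and> r_quotient r lam a = q a"
      by (intro partition_of_runners r qP charge_sum om)
    then obtain lam where lam: "lam \<in> partitions"
      "\<forall>a<r. charge r lam a = charge r om a" "\<forall>a<r. r_quotient r lam a = q a" by blast
    have "q a = restrict (r_quotient r lam) {..<r} a" for a
      using lam(3) PiE_arb[OF q, of a] by (cases "a < r") simp_all
    then have "q = restrict (r_quotient r lam) {..<r}" by (rule ext)
    moreover have "lam \<in> charge_class r om" using lam(1,2) by (simp add: charge_class_def)
    ultimately show "q \<in> (\<lambda>lam. restrict (r_quotient r lam) {..<r}) ` charge_class r om"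
      by (rule image_eqI)
  qed
qed

section \<open>The generating functions of a core class\<close>

lemma charge_class_gf:
  assumes r: "r > 0" and om: "om \<in> partitions"
  shows "finite_fibres (charge_class r om) (weight r)"
    "gen_fps (charge_class r om) (weight r) (\<lambda>_. 1 :: 'a::comm_ring_1) = partition_gf ^ r"
proof -
  let ?q = "\<lambda>lam. restrict (r_quotient r lam) {..<r}"
  note bij = quotient_bij[OF r om]
  note PiE = gen_fps_PiE[OF finite_fibres_partitions, of r]
  show "finite_fibres (charge_class r om) (weight r)"
    by (rule finite_fibres_inj[OF conjunct1[OF PiE] bij_betw_imp_inj_on[OF bij]])
      (erule bij_betw_apply[OF bij], simp add: weight_def)
  show "gen_fps (charge_class r om) (weight r) (\<lambda>_. 1 :: 'a) = partition_gf ^ r"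
    unfolding conjunct2[OF PiE, symmetric] by (rule gen_fps_reindex[OF bij, symmetric]) (simp_all add: weight_def)
qed

text \<open>
  The generating-function form of division with remainder on the gaps. A weight factor
  that only sees the quotient part \<open>mu\<close> splits off.
\<close>
lemma charge_class_factor:
  fixes c c' :: "(nat \<Rightarrow> nat) \<Rightarrow> 'a::comm_ring_1"
  assumes r: "r > 0" and om: "om \<in> partitions" "\<nexists>s. exchange r (seq01 om) s"
    and c: "\<And>mu nu. mu \<in> partitions \<Longrightarrow> nu \<in> small_gaps r om \<Longrightarrow> c (scale_add r mu nu) = c' mu"
  shows "gen_fps (charge_class r om) (weight r) c
    = gen_fps partitions psize c' * gen_fps (small_gaps r om) (weight r) (\<lambda>_. 1)"
proof -
  have sub: "small_gaps r om \<subseteq> charge_class r om" by (auto simp: small_gaps_def)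
  then have fin: "finite_fibres (small_gaps r om) (weight r)"
    using charge_class_gf(1)[OF r om(1)] finite_fibres_subset by blast
  have weight: "weight r (scale_add r mu nu) = psize mu + weight r nu"
    if "mu \<in> partitions" "nu \<in> small_gaps r om" for mu nu
  proof -
    have nu: "nu \<in> charge_class r om" "nu \<in> partitions"
      using that(2) by (auto simp: small_gaps_def charge_class_def)
    then have "scale_add r mu nu \<in> charge_class r om"
      using that(1) scale_add_partition(1) charge_scale_add[OF r] by (auto simp: charge_class_def)
    from psize_weight[OF r om this] psize_weight[OF r om nu(1)] scale_add_partition(2)[OF that(1) nu(2), of r]
    have "r * weight r (scale_add r mu nu) = r * (psize mu + weight r nu)" by (simp add: distrib_left)
    then show ?thesis using r by simp
  qed
  have "gen_fps (charge_class r om) (weight r) c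
      = gen_fps (partitions \<times> small_gaps r om) (\<lambda>(mu, nu). psize mu + weight r nu) (\<lambda>(mu, nu). c' mu * 1)"
    by (rule gen_fps_reindex[OF scale_add_bij[OF r]]) (use weight c in auto)
  then show ?thesis by (simp only: gen_fps_times[OF finite_fibres_partitions fin])
qed

text \<open>
  The gaps of \<open>nu\<close> are smaller than \<open>r\<close>, so they disappear in the integer quotients of
  \<open>prod_bottom_hooks\<close>.
\<close>
lemma prod_bottom_hooks_scale_add:
  fixes f :: "nat \<Rightarrow> 'a::comm_ring_1"
  assumes r: "r > 0" and mu: "mu \<in> partitions" and nu: "nu \<in> small_gaps r om"
  shows "(\<Prod>h\<in>#bottom_hooks r (scale_add r mu nu). f h) = (\<Prod>h\<in>#bottom_hooks 1 mu. f (r * h))"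
proof -
  have nuP: "nu \<in> partitions" and gap: "\<And>i. nu i - nu (Suc i) < r"
    using nu by (auto simp: small_gaps_def charge_class_def)
  obtain N where N: "mu N = 0" "nu N = 0" using mu nuP by (rule partitions_common_zero)
  have "scale_add r mu nu N = 0" using N by (simp add: scale_add_def)
  note * = prod_bottom_hooks[OF scale_add_partition(1)[OF mu nuP, of r] this r, of f]
  have "(scale_add r mu nu i - scale_add r mu nu (Suc i)) div r = mu i - mu (Suc i)" for i
    unfolding scale_add_gap[OF mu nuP] using gap[of i] r by simp
  then show ?thesis
    unfolding * using prod_bottom_hooks[OF mu N(1), of 1 "\<lambda>h. f (r * h)"] by simp
qed

lemma partition_gf_0: "fps_nth (partition_gf :: 'a::comm_ring_1 fps) 0 = 1"
proof -
  have "{lam. lam \<in> partitions \<and> psize lam = 0} = {\<lambda>_. 0}"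
    using psize_zero_iff zero_partition by auto
  then show ?thesis by (simp add: gen_fps_def)
qed

text \<open>
  Apply the factorisation with trivial weights, where the left-hand side is known from
  the \<open>r\<close>-quotient to be \<open>partition_gf ^ r\<close>, and cancel one factor \<open>partition_gf\<close>, which
  is invertible by Euler's formula.
\<close>
lemma small_gaps_gf:
  assumes r: "r > 0" and om: "om \<in> partitions" "\<nexists>s. exchange r (seq01 om) s"
  shows "gen_fps (small_gaps r om) (weight r) (\<lambda>_. 1 :: 'a::comm_ring_1) = partition_gf ^ (r - 1)"
proof -
  let ?P = "partition_gf :: 'a fps" and ?R = "gen_fps (small_gaps r om) (weight r) (\<lambda>_. 1 :: 'a)"
  let ?Q = "qpoch_inf fps_X fps_X :: 'a fps"
  have PR: "?P * ?R = ?P * ?P ^ (r - 1)"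
  proof -
    have "?P ^ r = ?P * ?P ^ (r - 1)" using r by (cases r) simp_all
    then show ?thesis
      using charge_class_factor[OF r om, of "\<lambda>_. 1" "\<lambda>_. 1 :: 'a"] charge_class_gf(2)[OF r om(1), where 'a='a] by simp
  qed
  have QP: "?Q * ?P = 1" using partition_gf_qpoch by (simp only: mult.commute)
  have "?R = ?Q * ?P * ?R" unfolding QP by (simp only: mult_1_left)
  also have "\<dots> = ?Q * ?P * ?P ^ (r - 1)" by (simp only: mult.assoc PR)
  also have "\<dots> = ?P ^ (r - 1)" unfolding QP by (simp only: mult_1_left)
  finally show ?thesis .
qed

text \<open>
  Identifies the formal quotient with multiplication by any given inverse of the
  denominator.
\<close>
lemma fps_quot1_unique:
  fixes F G P :: "'a::comm_ring_1 fps"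
  assumes "P * G = 1" "fps_nth G 0 = 1"
  shows "fps_quot1 F G = F * P"
proof -
  have "G * fps_right_inverse G 1 = 1" by (rule fps_right_inverse) (simp add: assms(2))
  then have "P = P * G * fps_right_inverse G 1" by (simp add: mult.assoc)
  then show ?thesis by (simp add: fps_quot1_def assms(1))
qed

theorem theorem6p1:
  fixes r :: nat and \<rho> :: "nat \<Rightarrow> 'a::comm_ring_1" and \<omega> :: "nat \<Rightarrow> nat"
  assumes "r > 0" and "is_r_core r \<omega>"
  shows "((\<lambda>lam. fps_X ^ ((psize lam - psize \<omega>) div r)
             * fps_const (\<Prod>h\<in>#bottom_hooks r lam. \<rho> h))
          has_sum fps_quot1 (f_series r \<rho>) (qpoch_inf fps_X fps_X ^ (r - 1)))
         {lam \<in> partitions. r_core r lam = \<omega>}"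
proof -
  let ?c = "\<lambda>lam. \<Prod>h\<in>#bottom_hooks r lam. \<rho> h"
  let ?P = "partition_gf :: 'a fps" and ?Q = "qpoch_inf fps_X fps_X :: 'a fps"
  note r = assms(1)
  have om: "\<omega> \<in> partitions" "\<nexists>s. exchange r (seq01 \<omega>) s"
    using assms(2) r_core_terminal[OF assms] by (auto simp: is_r_core_def)
  have C: "{lam \<in> partitions. r_core r lam = \<omega>} = charge_class r \<omega>"
    using r_core_iff[OF r _ om] by (auto simp: charge_class_def)
  have f: "f_series r \<rho> = gen_fps partitions psize (\<lambda>mu. \<Prod>h\<in>#bottom_hooks 1 mu. \<rho> (r * h))"
    unfolding f_series_def by (rule infsumI[OF has_sum_gen_fps[OF finite_fibres_partitions]])
  have "gen_fps (charge_class r \<omega>) (weight r) ?c = f_series r \<rho> * ?P ^ (r - 1)"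
    unfolding f small_gaps_gf[OF r om, symmetric]
    by (rule charge_class_factor[OF r om]) (rule prod_bottom_hooks_scale_add[OF r])
  also have "\<dots> = fps_quot1 (f_series r \<rho>) (?Q ^ (r - 1))"
  proof (rule fps_quot1_unique[symmetric])
    show "?P ^ (r - 1) * ?Q ^ (r - 1) = 1"
      by (simp only: power_mult_distrib[symmetric] partition_gf_qpoch power_one)
    have "fps_nth ?P 0 * fps_nth ?Q 0 = 1"
      using arg_cong[OF partition_gf_qpoch, of "\<lambda>f. fps_nth f 0"] by simp
    then have "fps_nth ?Q 0 = 1" by (simp add: partition_gf_0)
    then show "fps_nth (?Q ^ (r - 1)) 0 = 1" by (simp add: fps_power_zeroth)
  qed
  finally have "((\<lambda>lam. fps_X ^ weight r lam * fps_const (?c lam))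
      has_sum fps_quot1 (f_series r \<rho>) (?Q ^ (r - 1))) (charge_class r \<omega>)"
    using has_sum_gen_fps[OF charge_class_gf(1)[OF r om(1)], of ?c] by simp
  moreover have "(psize lam - psize \<omega>) div r = weight r lam" if "lam \<in> charge_class r \<omega>" for lam
    using psize_weight[OF r om that] r by simp
  ultimately show ?thesis unfolding C by (subst has_sum_cong) auto
qed

end
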